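(* Let $n\ge 2$ and $k\ge 4$ be integers. Then: (a) $\chi_\rho(S^n_{C_k})=4$ if $n=2$ and $k$ is even with $k\neq 6$; (b) $\chi_\rho(S^n_{C_k})=5$ if either $n\ge 3$ and $k\notin\{5,6,7\}$, or $n=2$ and $k\in\{6\}\cup\{k \text{ odd}: k\neq 5\}$; (c) $\chi_\rho(S^n_{C_k})=6$ if either $n\ge 3$ and $k\in\{6,7\}$, or $n\le 6$ and $k=5$. Moreover, if $n\ge 7$, then $6\le \chi_\rho(S^n_{C_5})\le 7$.
   Context: $C_k$ is the cycle with vertex set $[k]=\{0,\dots,k-1\}$ and edges $\{i,i+1\}$ (indices mod $k$). For a graph $G$ with vertex set $[k]$ and $n\ge 1$, the generalized Sierpi\'nski graph $S^n_G$ has vertex set $[k]^n$, and $u=u_1\cdots u_n$, $v=v_1\cdots v_n$ are adjacent iff there is $i$ with: $u_j=v_j$ for $j<i$; $u_i\neq v_i$ and $u_iv_i\in E(G)$; and $u_j=v_i$, $v_j=u_i$ for all $j>i$. A packing $c$-coloring of a graph $X$ is a map $f:V(X)\to\{1,\dots,c\}$ such that any two distinct vertices $u,v$ with $f(u)=f(v)=i$ satisfy $d_X(u,v)>i$; the packing chromatic number $\chi_\rho(X)$ is the least such $c$. *)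

theory Defs
  imports Main "HOL-Library.Extended_Nat"
begin

definition adj_on :: "'a set \<Rightarrow> ('a \<Rightarrow> 'a \<Rightarrow> bool) \<Rightarrow> 'a \<Rightarrow> 'a \<Rightarrow> bool" where
  "adj_on V E x y \<longleftrightarrow> x \<in> V \<and> y \<in> V \<and> E x y"

text \<open>Graph distance: least length of a walk; infinity if there is none.\<close>
definition gdist :: "'a set \<Rightarrow> ('a \<Rightarrow> 'a \<Rightarrow> bool) \<Rightarrow> 'a \<Rightarrow> 'a \<Rightarrow> enat" where
  "gdist V E u v = (INF m \<in> {m. (adj_on V E ^^ m) u v}. enat m)"

definition packing_coloring :: "'a set \<Rightarrow> ('a \<Rightarrow> 'a \<Rightarrow> bool) \<Rightarrow> nat \<Rightarrow> ('a \<Rightarrow> nat) \<Rightarrow> bool" where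
  "packing_coloring V E c f \<longleftrightarrow>
     (\<forall>v\<in>V. f v \<in> {1..c}) \<and>
     (\<forall>u\<in>V. \<forall>v\<in>V. u \<noteq> v \<and> f u = f v \<longrightarrow> gdist V E u v > enat (f u))"

definition packing_chromatic :: "'a set \<Rightarrow> ('a \<Rightarrow> 'a \<Rightarrow> bool) \<Rightarrow> nat" where
  "packing_chromatic V E = (LEAST c. \<exists>f. packing_coloring V E c f)"

definition cycle_adj :: "nat \<Rightarrow> nat \<Rightarrow> nat \<Rightarrow> bool" where
  "cycle_adj k i j \<longleftrightarrow> i < k \<and> j < k \<and> (j = (i + 1) mod k \<or> i = (j + 1) mod k)"

text \<open>Generalized Sierpinski graph S^n_G for G on [k]: words of length n over [k]
  (positions indexed 0..n-1 instead of 1..n).\<close>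
definition sierp_verts :: "nat \<Rightarrow> nat \<Rightarrow> nat list set" where
  "sierp_verts k n = {u. length u = n \<and> set u \<subseteq> {..<k}}"

definition sierp_adj :: "(nat \<Rightarrow> nat \<Rightarrow> bool) \<Rightarrow> nat list \<Rightarrow> nat list \<Rightarrow> bool" where
  "sierp_adj G u v \<longleftrightarrow> length u = length v \<and>
     (\<exists>i < length u. (\<forall>j < i. u ! j = v ! j) \<and> u ! i \<noteq> v ! i \<and> G (u ! i) (v ! i) \<and>
        (\<forall>j. i < j \<and> j < length u \<longrightarrow> u ! j = v ! i \<and> v ! j = u ! i))"

definition chi_rho_SC :: "nat \<Rightarrow> nat \<Rightarrow> nat" where
  "chi_rho_SC n k = packing_chromatic (sierp_verts k n) (sierp_adj (cycle_adj k))"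

end

theory Submission
  imports Defs
begin

text \<open>
  A vertex of the graph has at most three neighbours: two on its copy of \<open>C\<^sub>k\<close> (a block), where the last
  letter moves by one, and possibly one across. The \<open>k\<close> blocks with a common prefix form a ring, and rings
  are linked through the middle vertices of three consecutive blocks only.

  Upper bounds: the colour of a vertex depends on a finite type of its ring and on the relative positions
  of its block in the ring and of the vertex in the block. For even \<open>k\<close> the ring type is the parity of a
  letter. For odd \<open>k\<close> parity cannot alternate around the cycle, and a finite automaton reading the prefix
  keeps the defects away from the links. Long blocks and rings are obtained by repeating a segment of four
  classes, so that all short walks live in a finite quotient, where the colourings are checked. For
  \<open>k = 5\<close> six colours turn out to suffice for every \<open>n\<close>.

  Lower bounds: small subgraphs are refuted by branching. For odd \<open>k\<close> and four colours a window around
  two adjacent blocks shows that exactly one of the two middle vertices has colour 1, which is impossible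
  around an odd cycle. For \<open>k = 5\<close> and five colours the same argument applies to the blocks that contain
  colour 5.
\<close>

text \<open>The two kinds of bounds approximate the graph from opposite sides. For non-colourability
  it is enough to know some of the edges: a walk in a listed subgraph is a walk in the whole graph,
  so every distance conflict found there is real. For colourability every edge must be covered, and
  the quotient may have more walks than the graph; a spurious short walk between equal colours would
  spoil the check, which is why only walks that could be shortest are followed. The delicate point
  for odd \<open>k\<close> is a link between the prefixes \<open>w a b...b\<close> and
  \<open>w b a...a\<close> with \<open>b = a + 1\<close>. Its two ends should have opposite types,
  but the types of \<open>w a\<close> and \<open>w b\<close> fail to alternate at the one defect of
  their ring family. In that case \<open>w a\<close> carries the flag, and the family below
  \<open>w a\<close> puts its own defect between the positions \<open>0\<close> and
  \<open>1\<close>, so that the two irregularities cancel at the link. Hence such links always join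
  opposite unflagged types, and the defect is seen only by links between rings whose prefixes differ
  in the last letter alone.\<close>

section \<open>Distances, walks and packing colourings\<close>

lemma gdist_le_iff:
  "gdist V E u v \<le> enat d \<longleftrightarrow> (\<exists>m\<le>d. (adj_on V E ^^ m) u v)"
proof
  let ?S = "enat ` {m. (adj_on V E ^^ m) u v}"
  assume le: "gdist V E u v \<le> enat d"
  have eq: "gdist V E u v = Inf ?S" by (simp add: gdist_def)
  \<comment> \<open>The infimum of a set of walk lengths is attained only if the set is nonempty;
    the empty set would give infinity.\<close>
  have "?S \<noteq> {}"
  proof
    assume "?S = {}"
    then have "gdist V E u v = \<infinity>" unfolding eq by (simp add: top_enat_def)
    with le show False by simp
  qed
  then obtain x where "x \<in> ?S" by blast
  then have "Inf ?S \<in> ?S" by (rule wellorder_InfI)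
  then obtain m where "(adj_on V E ^^ m) u v" "gdist V E u v = enat m" unfolding eq by auto
  with le show "\<exists>m\<le>d. (adj_on V E ^^ m) u v" by auto
next
  assume "\<exists>m\<le>d. (adj_on V E ^^ m) u v"
  then obtain m where "m \<le> d" "(adj_on V E ^^ m) u v" by blast
  then show "gdist V E u v \<le> enat d"
    unfolding gdist_def by (intro INF_lower2[of m]) auto
qed

lemma packing_coloring_iff:
  "packing_coloring V E c f \<longleftrightarrow> (\<forall>v\<in>V. f v \<in> {1..c}) \<and>
     (\<forall>u\<in>V. \<forall>v\<in>V. \<forall>m. u \<noteq> v \<and> f u = f v \<and> (adj_on V E ^^ m) u v \<longrightarrow> f u < m)"
proof -
  have "gdist V E u v > enat d \<longleftrightarrow> (\<forall>m. (adj_on V E ^^ m) u v \<longrightarrow> d < m)" for u v d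
    using gdist_le_iff[of V E u v d] by (metis not_le)
  then show ?thesis unfolding packing_coloring_def by blast
qed

lemma packing_coloring_mono:
  assumes "packing_coloring V E c f" "c \<le> c'"
  shows "packing_coloring V E c' f"
  using assms unfolding packing_coloring_def by force

lemma packing_chromatic_eqI:
  assumes "packing_coloring V E (Suc c) f" "\<And>f. \<not> packing_coloring V E c f"
  shows "packing_chromatic V E = Suc c"
  unfolding packing_chromatic_def
proof (rule Least_equality)
  show "\<exists>f. packing_coloring V E (Suc c) f" using assms(1) by blast
  fix y assume "\<exists>f. packing_coloring V E y f"
  then show "Suc c \<le> y" using assms(2) packing_coloring_mono not_less_eq_eq by blast
qed

lemma walk_map:
  assumes "(adj_on V' E' ^^ m) u v"
    and "\<And>x. x \<in> V' \<Longrightarrow> \<phi> x \<in> V"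
    and "\<And>x y. x \<in> V' \<Longrightarrow> y \<in> V' \<Longrightarrow> E' x y \<Longrightarrow> E (\<phi> x) (\<phi> y)"
  shows "(adj_on V E ^^ m) (\<phi> u) (\<phi> v)"
  using assms(1)
proof (induction m arbitrary: v)
  case (Suc m)
  then show ?case using assms(2,3) unfolding adj_on_def by fastforce
qed auto

text \<open>An edge-preserving map turns walks into walks of the same length, so it cannot increase
  distances, and injectivity keeps distinct vertices distinct. The image need not be an induced or
  isometric copy.\<close>

lemma packing_coloring_pullback:
  assumes "packing_coloring V E c f"
    and "inj_on \<phi> V'"
    and "\<And>x. x \<in> V' \<Longrightarrow> \<phi> x \<in> V"
    and "\<And>x y. x \<in> V' \<Longrightarrow> y \<in> V' \<Longrightarrow> E' x y \<Longrightarrow> E (\<phi> x) (\<phi> y)"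
  shows "packing_coloring V' E' c (\<lambda>x. f (\<phi> x))"
  unfolding packing_coloring_iff
proof (intro conjI ballI allI impI)
  fix v assume "v \<in> V'"
  then show "f (\<phi> v) \<in> {1..c}" using assms(1,3) unfolding packing_coloring_iff by blast
next
  fix u v m assume "u \<in> V'" "v \<in> V'"
    and *: "u \<noteq> v \<and> f (\<phi> u) = f (\<phi> v) \<and> (adj_on V' E' ^^ m) u v"
  then have "\<phi> u \<in> V" "\<phi> v \<in> V" "\<phi> u \<noteq> \<phi> v" using assms(2,3) by (auto dest: inj_onD)
  moreover have "(adj_on V E ^^ m) (\<phi> u) (\<phi> v)"
    by (rule walk_map[where V' = V' and E' = E']) (use * assms(3,4) in simp_all)
  ultimately show "f (\<phi> u) < m"
    using * assms(1) unfolding packing_coloring_iff by blast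
qed

subsection \<open>Refutation by branching\<close>

text \<open>\<open>Br v ts\<close> splits on the colour of vertex \<open>v\<close>; \<open>ts\<close> has one entry for every colour still allowed
  there. Colours are shifted to start with \<open>0\<close>, and the allowed colours of a vertex are kept as a list
  of truth values, since this is what the simplifier evaluates fast.\<close>

datatype branching = Br nat "branching list"

text \<open>\<open>row\<close> is a row of a conflict matrix: it marks the vertices too close to the
  one that has just received the colour \<open>x\<close>.\<close>

fun forbid :: "nat \<Rightarrow> bool list \<Rightarrow> bool list list \<Rightarrow> bool list list" where
  "forbid x (True # row) (cs # ds) = cs[x := False] # forbid x row ds"
| "forbid x (False # row) (cs # ds) = cs # forbid x row ds"
| "forbid x [] ds = []"
| "forbid x (r # row) [] = []"

text \<open>A branch is closed when a vertex has no colour left: its list then contains no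
  \<open>True\<close>, and \<open>Br v []\<close> succeeds. Forbidden colours consume no
  subtree.\<close>

fun refutes :: "bool list list list \<Rightarrow> branching \<Rightarrow> bool list list \<Rightarrow> bool"
and refutes_all :: "bool list list list \<Rightarrow> nat \<Rightarrow> nat \<Rightarrow> bool list \<Rightarrow> branching list \<Rightarrow>
  bool list list \<Rightarrow> bool" where
  "refutes M (Br v ts) ds = refutes_all M v 0 (ds ! v) ts ds"
| "refutes_all M v x [] ts ds = True"
| "refutes_all M v x (False # bs) ts ds = refutes_all M v (Suc x) bs ts ds"
| "refutes_all M v x (True # bs) [] ds = False"
| "refutes_all M v x (True # bs) (t # ts) ds =
     (if refutes M t (forbid x (M ! x ! v) ds) then refutes_all M v (Suc x) bs ts ds else False)"

definition unit_rows :: "nat \<Rightarrow> bool list list" where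
  "unit_rows n = map (\<lambda>i. map (\<lambda>j. i = j) [0..<n]) [0..<n]"

definition spread :: "nat list list \<Rightarrow> bool list list \<Rightarrow> bool list list" where
  "spread adj R = map2 (\<lambda>ns row. foldr (\<lambda>w. map2 (\<or>) (R ! w)) ns row) adj R"

fun near :: "nat list list \<Rightarrow> nat \<Rightarrow> bool list list \<Rightarrow> bool list list list" where
  "near adj 0 R = []"
| "near adj (Suc c) R = (let R' = spread adj R in R' # near adj c R')"

definition off_diagonal :: "bool list list \<Rightarrow> bool list list \<Rightarrow> bool list list" where
  "off_diagonal U R = map2 (map2 (\<lambda>u b. b \<and> \<not> u)) U R"

text \<open>Entry \<open>x\<close> relates distinct vertices joined by a walk of at most
  \<open>x + 1\<close> steps, the range in which the shifted colour \<open>x\<close> must not be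
  repeated.\<close>

definition conflicts :: "nat list list \<Rightarrow> nat \<Rightarrow> bool list list list" where
  "conflicts adj c =
     (let U = unit_rows (length adj) in map (off_diagonal U) (near adj c U))"

lemma length_forbid [simp]:
  "length row = length ds \<Longrightarrow> length (forbid x row ds) = length ds"
  by (induction x row ds rule: forbid.induct) auto

lemma nth_forbid:
  "length row = length ds \<Longrightarrow> i < length ds \<Longrightarrow>
     forbid x row ds ! i = (if row ! i then (ds ! i)[x := False] else ds ! i)"
  by (induction x row ds arbitrary: i rule: forbid.induct) (auto simp: nth_Cons split: nat.split)

definition admits :: "nat \<Rightarrow> (nat \<Rightarrow> nat) \<Rightarrow> bool list list \<Rightarrow> bool" where
  "admits N g ds \<longleftrightarrow> length ds = N \<and> (\<forall>i<N. g i < length (ds ! i) \<and> ds ! i ! g i)"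

fun in_range :: "nat \<Rightarrow> branching \<Rightarrow> bool" where
  "in_range N (Br v ts) \<longleftrightarrow> v < N \<and> list_all (in_range N) ts"

lemma admits_forbid:
  assumes "admits N g ds" "length row = N" "\<And>i. i < N \<Longrightarrow> row ! i \<Longrightarrow> g i \<noteq> x"
  shows "admits N g (forbid x row ds)"
  using assms by (auto simp: admits_def nth_forbid) (metis nth_list_update_neq)

definition separated :: "nat \<Rightarrow> nat \<Rightarrow> (nat \<Rightarrow> nat) \<Rightarrow> bool list list list \<Rightarrow> bool" where
  "separated c N g M \<longleftrightarrow> (\<forall>x<c. \<forall>i<N. length (M ! x ! i) = N) \<and> (\<forall>i<N. g i < c) \<and>
     (\<forall>i<N. \<forall>j<N. g i = g j \<longrightarrow> \<not> M ! g i ! i ! j)"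

text \<open>In the second part \<open>bs\<close> stands for the allowed colours of \<open>v\<close>
  from \<open>x\<close> on, so the colour \<open>g v\<close> sits at index \<open>g v - x\<close>.
  When the loop arrives at it, propagation leaves \<open>g\<close> admissible, and the subtree for
  this colour gives the contradiction.\<close>

lemma refutes_imp_not_admits:
  shows "refutes M t ds \<Longrightarrow> separated c N g M \<Longrightarrow> in_range N t \<Longrightarrow> \<not> admits N g ds"
    and "refutes_all M v x bs ts ds \<Longrightarrow> separated c N g M \<Longrightarrow> v < N \<Longrightarrow>
      list_all (in_range N) ts \<Longrightarrow> x \<le> g v \<Longrightarrow> g v - x < length bs \<Longrightarrow> bs ! (g v - x) \<Longrightarrow>
      \<not> admits N g ds"
proof (induction M t ds and M v x bs ts ds rule: refutes_refutes_all.induct)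
  case (1 M v ts ds)
  then show ?case by (auto simp: admits_def)
next
  case (2 M v x ts ds)
  then show ?case by simp
next
  case (3 M v x bs ts ds)
  then have "x \<noteq> g v" by auto
  then have "Suc x \<le> g v" "g v - x = Suc (g v - Suc x)" using 3 by auto
  with 3 show ?case by auto
next
  case (4 M v x bs ds)
  then show ?case by simp
next
  case (5 M v x bs t ts ds)
  have t: "refutes M t (forbid x (M ! x ! v) ds)" "refutes_all M v (Suc x) bs ts ds"
    using "5.prems" by (auto split: if_splits)
  show ?case
  proof (cases "x = g v")
    case True
    have "\<not> admits N g (forbid x (M ! x ! v) ds)" using 5 t by auto
    moreover have "length (M ! x ! v) = N" using True "5.prems" by (auto simp: separated_def)
    moreover have "g i \<noteq> x" if "i < N" "M ! x ! v ! i" for i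
      using that True "5.prems"(2,3) unfolding separated_def by metis
    ultimately show ?thesis using admits_forbid by blast
  next
    case False
    then have "Suc x \<le> g v" "g v - x = Suc (g v - Suc x)" using 5 by auto
    then show ?thesis using 5 t by auto
  qed
qed

context
  fixes adj :: "nat list list" and V :: "'a set" and E and \<phi> :: "nat \<Rightarrow> 'a"
  assumes nbrs: "\<And>i j. i < length adj \<Longrightarrow> j \<in> set (adj ! i) \<Longrightarrow>
    j < length adj \<and> adj_on V E (\<phi> i) (\<phi> j)"
begin

text \<open>One direction suffices: a true entry must be witnessed by a walk, whereas a walk missing
  from the table only makes a refutation harder.\<close>

definition reaches :: "nat \<Rightarrow> bool list list \<Rightarrow> bool" where
  "reaches d R \<longleftrightarrow> length R = length adj \<and> (\<forall>i<length adj. length (R ! i) = length adj \<and>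
     (\<forall>j<length adj. R ! i ! j \<longrightarrow> (\<exists>m\<le>d. (adj_on V E ^^ m) (\<phi> i) (\<phi> j))))"

lemma reaches_unit: "reaches 0 (unit_rows (length adj))"
  by (auto simp: reaches_def unit_rows_def)

lemma reaches_spread:
  assumes "reaches d R"
  shows "reaches (Suc d) (spread adj R)"
proof -
  let ?N = "length adj"
  have "length (foldr (\<lambda>w. map2 (\<or>) (R ! w)) ns row) = ?N \<and>
      (\<forall>j<?N. foldr (\<lambda>w. map2 (\<or>) (R ! w)) ns row ! j \<longrightarrow>
        (\<exists>m\<le>Suc d. (adj_on V E ^^ m) (\<phi> i) (\<phi> j)))"
    if "i < ?N" "set ns \<subseteq> set (adj ! i)" "row = R ! i" for i ns row
    using that(2)
  proof (induction ns)
    case Nil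
    then show ?case using assms that unfolding reaches_def by auto (meson le_SucI)
  next
    case (Cons w ns)
    have w: "w < ?N" "adj_on V E (\<phi> i) (\<phi> w)" using nbrs[OF that(1)] Cons.prems by auto
    have "\<exists>m\<le>Suc d. (adj_on V E ^^ m) (\<phi> i) (\<phi> j)" if j: "j < ?N" "R ! w ! j" for j
    proof -
      obtain m where "m \<le> d" "(adj_on V E ^^ m) (\<phi> w) (\<phi> j)"
        using assms w j unfolding reaches_def by blast
      then show ?thesis using relpowp_Suc_I2[of "adj_on V E", OF w(2)]
        by (intro exI[of _ "Suc m"]) blast
    qed
    moreover have "length (R ! w) = ?N" using assms w unfolding reaches_def by blast
    ultimately show ?case using Cons by auto
  qed
  note step = this[OF _ order_refl refl]
  have "length R = ?N" using assms unfolding reaches_def by blast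
  then show ?thesis using step unfolding reaches_def by (simp add: spread_def)
qed

lemma reaches_near:
  "reaches d R \<Longrightarrow> x < c \<Longrightarrow> reaches (d + Suc x) (near adj c R ! x)"
proof (induction c arbitrary: d R x)
  case (Suc c)
  show ?case
  proof (cases x)
    case 0
    then show ?thesis using reaches_spread[OF Suc.prems(1)] by (simp add: Let_def)
  next
    case (Suc y)
    then show ?thesis
      using Suc.IH[OF reaches_spread[OF Suc.prems(1)], of y] Suc.prems(2) by (simp add: Let_def)
  qed
qed simp

lemma length_near: "length (near adj c R) = c"
  by (induction c arbitrary: R) (auto simp: Let_def)

lemma conflicts_sound:
  assumes "x < c" "i < length adj"
  shows "length (conflicts adj c ! x ! i) = length adj"
    and "j < length adj \<Longrightarrow> conflicts adj c ! x ! i ! j \<Longrightarrow>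
      i \<noteq> j \<and> (\<exists>m\<le>Suc x. (adj_on V E ^^ m) (\<phi> i) (\<phi> j))"
  using reaches_near[OF reaches_unit assms(1)] assms
  unfolding conflicts_def Let_def reaches_def off_diagonal_def
  by (auto simp: length_near unit_rows_def)

lemma refutes_sound:
  assumes "refutes (conflicts adj c) t ds" "in_range (length adj) t"
    and f: "packing_coloring V E c f"
    and inj: "inj_on \<phi> {..<length adj}"
    and V: "\<And>i. i < length adj \<Longrightarrow> \<phi> i \<in> V"
  shows "\<not> admits (length adj) (\<lambda>i. f (\<phi> i) - 1) ds"
proof (rule refutes_imp_not_admits(1)[where c = c, OF assms(1) _ assms(2)])
  let ?N = "length adj"
  have f1: "f (\<phi> i) \<ge> 1" "f (\<phi> i) \<le> c" if "i < ?N" for i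
    using f V[OF that] unfolding packing_coloring_iff by auto
  have "\<not> conflicts adj c ! (f (\<phi> i) - 1) ! i ! j"
    if ij: "i < ?N" "j < ?N" "f (\<phi> i) - 1 = f (\<phi> j) - 1" for i j
  proof
    assume *: "conflicts adj c ! (f (\<phi> i) - 1) ! i ! j"
    have eq: "f (\<phi> i) = f (\<phi> j)" using f1 ij by (metis le_add_diff_inverse)
    have "f (\<phi> i) - 1 < c" using f1[OF ij(1)] by linarith
    then obtain m where m: "i \<noteq> j" "m \<le> Suc (f (\<phi> i) - 1)" "(adj_on V E ^^ m) (\<phi> i) (\<phi> j)"
      using conflicts_sound(2)[OF _ ij(1,2) *] by blast
    have "\<phi> i \<noteq> \<phi> j" using inj m(1) ij by (auto dest: inj_onD)
    then have "f (\<phi> i) < m"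
      using f eq m(3) V ij unfolding packing_coloring_iff by blast
    then show False using m(2) f1(1)[OF ij(1)] by linarith
  qed
  moreover have "f (\<phi> i) - 1 < c" if "i < ?N" for i using f1[OF that] by linarith
  ultimately show "separated c ?N (\<lambda>i. f (\<phi> i) - 1) (conflicts adj c)"
    using conflicts_sound(1) by (auto simp: separated_def)
qed

end

subsection \<open>Colourings from a finite quotient\<close>

text \<open>The part of a walk between two visits of a vertex can be cut out, which contradicts
  minimal length.\<close>

lemma shortest_walk:
  assumes "(P ^^ m) u v"
  obtains n p where "n \<le> m" "p 0 = u" "p n = v" "\<And>i. i < n \<Longrightarrow> P (p i) (p (Suc i))"
    "inj_on p {..n::nat}"
proof -
  define n where "n = (LEAST n. (P ^^ n) u v)"
  have n: "(P ^^ n) u v" "n \<le> m" using assms unfolding n_def by (auto intro: LeastI Least_le)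
  have least: "n \<le> i" if "(P ^^ i) u v" for i using that unfolding n_def by (rule Least_le)
  obtain p where p: "p 0 = u" "p n = v" "\<And>i. i < n \<Longrightarrow> P (p i) (p (Suc i))"
    using n(1) unfolding relpowp_fun_conv by blast
  have no_repeat: False if "i < j" "j \<le> n" "p i = p j" for i j
  proof -
    have "(P ^^ i) u (p i)" unfolding relpowp_fun_conv using p that by (intro exI[of _ p]) auto
    moreover have "(P ^^ (n - j)) (p j) v"
      unfolding relpowp_fun_conv using p that by (intro exI[of _ "\<lambda>i. p (j + i)"]) auto
    ultimately have "(P ^^ (i + (n - j))) u v" unfolding relpowp_add that(3) by blast
    from least[OF this] show False using that by linarith
  qed
  have "inj_on p {..n}"
    by (intro inj_onI) (metis atMost_iff linorder_neqE_nat no_repeat)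
  with that[of n p] n(2) p show ?thesis by blast
qed

section \<open>Labelled edges and the simulation of shortest walks\<close>

datatype dir = Fwd | Bwd | Cross

fun opposite :: "dir \<Rightarrow> dir" where
  "opposite Fwd = Bwd"
| "opposite Bwd = Fwd"
| "opposite Cross = Cross"

text \<open>The labels make the graph deterministic: a vertex has at most one edge with each label,
  so turning back and running around a block can be recognised from labels alone.
  \<open>Suc m\<close> keeps the edges inside a block, whose run is empty, out of
  \<open>Cross\<close>.\<close>

fun edge :: "nat \<Rightarrow> dir \<Rightarrow> nat list \<Rightarrow> nat list \<Rightarrow> bool" where
  "edge k Fwd u v \<longleftrightarrow> (\<exists>w a. a < k \<and> u = w @ [a] \<and> v = w @ [Suc a mod k])"
| "edge k Bwd u v \<longleftrightarrow> (\<exists>w a. a < k \<and> u = w @ [Suc a mod k] \<and> v = w @ [a])"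
| "edge k Cross u v \<longleftrightarrow> (\<exists>w a b m. a \<noteq> b \<and> cycle_adj k a b \<and>
     u = w @ a # replicate (Suc m) b \<and> v = w @ b # replicate (Suc m) a)"

lemma sierp_adj_iff:
  "sierp_adj G u v \<longleftrightarrow>
     (\<exists>w a b m. a \<noteq> b \<and> G a b \<and> u = w @ a # replicate m b \<and> v = w @ b # replicate m a)"
proof
  assume "sierp_adj G u v"
  then obtain i where i: "length u = length v" "i < length u" "\<forall>j<i. u ! j = v ! j"
      "u ! i \<noteq> v ! i" "G (u ! i) (v ! i)"
      "\<forall>j. i < j \<and> j < length u \<longrightarrow> u ! j = v ! i \<and> v ! j = u ! i"
    unfolding sierp_adj_def by blast
  have "take i u = take i v" using i by (intro nth_take_lemma) auto
  moreover have "drop (Suc i) u = replicate (length u - Suc i) (v ! i)"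
    using i by (intro replicate_eqI) (auto simp: in_set_conv_nth)
  moreover have "drop (Suc i) v = replicate (length u - Suc i) (u ! i)"
    using i by (intro replicate_eqI) (auto simp: in_set_conv_nth)
  ultimately have "u = take i u @ u ! i # replicate (length u - Suc i) (v ! i)"
      "v = take i u @ v ! i # replicate (length u - Suc i) (u ! i)"
    using id_take_nth_drop[of i u] id_take_nth_drop[of i v] i by auto
  then show "\<exists>w a b m. a \<noteq> b \<and> G a b \<and> u = w @ a # replicate m b \<and> v = w @ b # replicate m a"
    using i by blast
next
  assume "\<exists>w a b m. a \<noteq> b \<and> G a b \<and> u = w @ a # replicate m b \<and> v = w @ b # replicate m a"
  then obtain w a b m where "a \<noteq> b" "G a b" "u = w @ a # replicate m b" "v = w @ b # replicate m a"
    by blast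
  then show "sierp_adj G u v"
    unfolding sierp_adj_def
    by (intro conjI exI[of _ "length w"]) (auto simp: nth_append nth_Cons split: nat.split)
qed

lemma edge_exists:
  assumes "sierp_adj (cycle_adj k) u v"
  obtains l where "edge k l u v"
proof -
  obtain w a b m where *: "a \<noteq> b" "cycle_adj k a b" "u = w @ a # replicate m b"
      "v = w @ b # replicate m a"
    using assms unfolding sierp_adj_iff by blast
  show ?thesis
  proof (cases m)
    case 0
    then have "edge k Fwd u v \<or> edge k Bwd u v" using * by (auto simp: cycle_adj_def)
    then show ?thesis using that by blast
  next
    case (Suc m')
    then have "edge k Cross u v" using * by auto
    then show ?thesis using that by blast
  qed
qed

lemma cycle_adj_sym: "cycle_adj k a b \<longleftrightarrow> cycle_adj k b a"
  by (auto simp: cycle_adj_def)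

lemma edge_opposite:
  assumes "edge k l u v"
  shows "edge k (opposite l) v u"
proof (cases l)
  case Cross
  then obtain w a b m where "a \<noteq> b" "cycle_adj k a b" "u = w @ a # replicate (Suc m) b"
      "v = w @ b # replicate (Suc m) a"
    using assms unfolding Cross edge.simps by blast
  then have "b \<noteq> a \<and> cycle_adj k b a \<and> v = w @ b # replicate (Suc m) a \<and>
      u = w @ a # replicate (Suc m) b"
    using cycle_adj_sym by blast
  then show ?thesis unfolding Cross opposite.simps edge.simps by blast
qed (use assms in auto)

lemma Suc_mod_inj: "a < k \<Longrightarrow> b < k \<Longrightarrow> Suc a mod k = Suc b mod k \<Longrightarrow> a = (b::nat)"
  by (auto simp: mod_Suc split: if_splits)

text \<open>The last letter is \<open>b\<close>, and the final run of \<open>b\<close> is maximal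
  since \<open>a\<close> differs from it; so the word determines its decomposition.\<close>

lemma tail_run_unique:
  assumes "w @ a # replicate (Suc m) b = w' @ a' # replicate (Suc m') b'" "a \<noteq> b" "a' \<noteq> b'"
  shows "w = w' \<and> a = a' \<and> b = b' \<and> m = m'"
proof -
  have b: "b = b'" using arg_cong[OF assms(1), of last] by (simp split: if_splits)
  have run: "takeWhile ((=) y) (rev (z @ x # replicate (Suc j) y)) = replicate (Suc j) y"
    if "x \<noteq> y" for x y :: 'a and z j
  proof -
    have "takeWhile ((=) y) (replicate j y @ x # r) = replicate j y" for j r
      using that by (induction j) auto
    from this[of "Suc j" "rev z"] show ?thesis by (simp add: replicate_append_same)
  qed
  have "Suc m = Suc m'" using run[OF assms(2)] run[OF assms(3)] assms(1) b
    by (metis length_replicate)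
  then show ?thesis using assms(1) b by auto
qed

lemma edge_unique: "edge k l u v \<Longrightarrow> edge k l u v' \<Longrightarrow> v = v'"
proof (cases l)
  case Cross
  assume "edge k l u v" "edge k l u v'"
  then show ?thesis unfolding Cross edge.simps using tail_run_unique by metis
qed (auto dest: Suc_mod_inj)

lemma edge_run:
  assumes "\<And>i. i < n \<Longrightarrow> edge k Fwd (p i) (p (Suc i))" "p 0 = w @ [a]" "a < k"
  shows "p n = w @ [(a + n) mod k]"
  using assms(1)
proof (induction n)
  case (Suc n)
  have "edge k Fwd (p n) (p (Suc n))" using Suc.prems by blast
  moreover have "p n = w @ [(a + n) mod k]"
    by (rule Suc.IH, rule Suc.prems) simp
  ultimately show ?case by (auto simp: mod_Suc_eq)
qed (use assms in simp)

text \<open>Moving in one direction inside a block closes after \<open>k\<close> steps (a backward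
  run, read in reverse, is a forward one), while a second crossing already undoes the first.\<close>

lemma edge_run_closes:
  assumes "\<And>i. i < k \<Longrightarrow> edge k l (p i) (p (Suc i))" "k \<ge> 2"
  shows "p k = p 0 \<or> p 2 = p 0"
proof (cases l)
  case Fwd
  have "edge k Fwd (p 0) (p (Suc 0))" using assms Fwd by auto
  then obtain w a where "p 0 = w @ [a]" "a < k" by auto
  then show ?thesis using edge_run[of k k p w a] assms Fwd by simp
next
  case Bwd
  let ?q = "\<lambda>i. p (k - i)"
  have "edge k Fwd (?q i) (?q (Suc i))" if "i < k" for i
    using assms(1)[of "k - Suc i"] that edge_opposite[of k Bwd] Bwd by (simp add: Suc_diff_Suc)
  moreover from this[of 0] obtain w a where "?q 0 = w @ [a]" "a < k" using assms(2) by auto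
  ultimately show ?thesis using edge_run[of k k ?q w a] by simp
next
  case Cross
  have "edge k Cross (p 1) (p 0)" "edge k Cross (p 1) (p 2)"
    using assms(1)[of 0] assms(1)[of 1] assms(2) Cross edge_opposite[of k Cross "p 0" "p 1"]
    by (auto simp: numeral_2_eq_2 simp del: edge.simps)
  then show ?thesis using edge_unique by blast
qed

text \<open>The state \<open>y\<close> is reached by a walk that ends with \<open>t\<close> steps labelled \<open>l\<close>; no continuation of it by
  fewer than \<open>d\<close> steps may end in colour \<open>c\<close>. A shortest walk repeats no vertex, so it neither turns
  back nor takes \<open>K = k\<close> equal steps around a copy of the cycle.\<close>

fun safe :: "(dir \<Rightarrow> 's \<Rightarrow> 's list) \<Rightarrow> ('s \<Rightarrow> nat) \<Rightarrow> nat \<Rightarrow> nat \<Rightarrow> nat \<Rightarrow> nat \<Rightarrow> dir \<Rightarrow> 's \<Rightarrow> bool"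
where
  "safe step col K c 0 t l y = True"
| "safe step col K c (Suc d) t l y = (t = K \<or> col y \<noteq> c \<and>
     list_all (\<lambda>l'. l' = opposite l \<or>
       list_all (safe step col K c d (if l' = l then Suc t else 1) l') (step l' y)) [Fwd, Bwd, Cross])"

text \<open>A walk that violates the colouring can be replaced by a shortest one with the same ends,
  whose states follow \<open>step\<close>; extra successors in \<open>step\<close> do no harm. If
  \<open>c < K\<close>, no walk of at most \<open>c\<close> steps contains \<open>K\<close> equal
  steps, so the cutoff has an effect only for \<open>K = k\<close>.\<close>

lemma packing_coloring_of_states:
  fixes st :: "nat list \<Rightarrow> 's"
  assumes k: "k \<ge> 2" and K: "K = k \<or> c < K"
    and sim: "\<And>u v l. u \<in> V \<Longrightarrow> v \<in> V \<Longrightarrow> edge k l u v \<Longrightarrow> st v \<in> set (step l (st u))"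
    and V: "V = sierp_verts k n"
    and col: "\<And>u. u \<in> V \<Longrightarrow> col (st u) \<in> {1..c}"
    and safe: "\<And>u l y. u \<in> V \<Longrightarrow> y \<in> set (step l (st u)) \<Longrightarrow>
       safe step col K (col (st u)) (col (st u)) 1 l y"
  shows "packing_coloring V (sierp_adj (cycle_adj k)) c (\<lambda>u. col (st u))"
  unfolding packing_coloring_iff
proof (intro conjI ballI allI impI)
  show "col (st u) \<in> {1..c}" if "u \<in> V" for u using col that .
next
  fix u v m assume uv: "u \<in> V" "v \<in> V" and *: "u \<noteq> v \<and> col (st u) = col (st v) \<and>
    (adj_on V (sierp_adj (cycle_adj k)) ^^ m) u v"
  let ?c = "col (st u)"
  have walk: "(adj_on V (sierp_adj (cycle_adj k)) ^^ m) u v" using * by blast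
  obtain n p where np: "n \<le> m" "p 0 = u" "p n = v" "inj_on p {..n}"
    and adj: "\<And>i. i < n \<Longrightarrow> adj_on V (sierp_adj (cycle_adj k)) (p i) (p (Suc i))"
    by (rule shortest_walk[OF walk]) blast
  have "\<exists>l. edge k l (p i) (p (Suc i))" if "i < n" for i
    using adj[OF that] edge_exists unfolding adj_on_def by metis
  then obtain lb where lb: "\<And>i. i < n \<Longrightarrow> edge k (lb i) (p i) (p (Suc i))" by metis
  have pV: "p i \<in> V" if "i \<le> n" for i
    using adj[of i] adj[of "i - 1"] that np uv unfolding adj_on_def by (cases "i = n") auto
  have step: "st (p (Suc i)) \<in> set (step (lb i) (st (p i)))" if "i < n" for i
    using sim lb pV that by auto
  have distinct: "p i \<noteq> p j" if "i < j" "j \<le> n" for i j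
    using np(4) that unfolding inj_on_def by force
  have turn: "lb (Suc i) \<noteq> opposite (lb i)" if "Suc i < n" for i
  proof
    assume "lb (Suc i) = opposite (lb i)"
    then have "edge k (lb (Suc i)) (p (Suc i)) (p i)" using lb[of i] edge_opposite that by auto
    then have "p i = p (Suc (Suc i))" using edge_unique lb[of "Suc i"] that by blast
    then show False using distinct[of i "Suc (Suc i)"] that by auto
  qed
  \<comment> \<open>A run of length \<open>K\<close> within the first \<open>c\<close> steps forces
    \<open>K = k\<close>; it then closes up and repeats a vertex.\<close>
  have run: "t \<noteq> K" if t: "t \<le> Suc i" "i < n" "i < c" "\<And>j. j < t \<Longrightarrow> lb (i - j) = lb i" for t i
  proof
    assume "t = K"
    then have tk: "t = k" using K t by auto
    let ?q = "\<lambda>j. p (Suc i - t + j)"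
    have edges: "edge k (lb i) (?q j) (?q (Suc j))" if "j < k" for j
      using lb[of "Suc i - t + j"] t(4)[of "t - Suc j"] that t(1,2) tk by auto
    have "?q k = ?q 0 \<or> ?q 2 = ?q 0"
      by (rule edge_run_closes[where p = ?q and l = "lb i", OF _ k]) (rule edges)
    moreover have "Suc i - t + k \<le> n" "Suc i - t + 2 \<le> n" using t(1,2) tk k by linarith+
    ultimately show False
      using distinct[of "Suc i - t" "Suc i - t + k"] distinct[of "Suc i - t" "Suc i - t + 2"] k
      by auto
  qed
  \<comment> \<open>After \<open>i + 1\<close> steps the remaining depth is \<open>?c - i\<close>,
    still positive for \<open>i + 1 = ?c\<close>; hence the end of a walk of length exactly
    \<open>?c\<close> is tested as well.\<close>
  have inv: "i < n \<Longrightarrow> i < ?c \<Longrightarrow> \<exists>t\<le>Suc i. (\<forall>j<t. lb (i - j) = lb i) \<and>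
      safe step col K ?c (?c - i) t (lb i) (st (p (Suc i)))" for i
  proof (induction i)
    case 0
    then show ?case using safe[OF uv(1)] step[of 0] np(2) by (intro exI[of _ 1]) auto
  next
    case (Suc i)
    then obtain t where t: "t \<le> Suc i" "\<And>j. j < t \<Longrightarrow> lb (i - j) = lb i"
      and s: "safe step col K ?c (?c - i) t (lb i) (st (p (Suc i)))" by auto
    have "i < c" using Suc.prems col[OF uv(1)] by auto
    then have "t \<noteq> K" using run[OF t(1)] t(2) Suc.prems by auto
    moreover have d: "?c - i = Suc (?c - Suc i)" using Suc.prems by auto
    ultimately have "safe step col K ?c (?c - Suc i) (if lb (Suc i) = lb i then Suc t else 1)
        (lb (Suc i)) (st (p (Suc (Suc i))))"
      using s turn[of i] step[of "Suc i"] Suc.prems unfolding d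
      by (cases "lb (Suc i)") (auto simp: list_all_iff split: if_splits)
    moreover have "lb (Suc i - j) = lb (Suc i)" if "lb (Suc i) = lb i" "j < Suc t" for j
      using that t by (cases j) auto
    ultimately show ?case
      using t(1) by (intro exI[of _ "if lb (Suc i) = lb i then Suc t else 1"]) auto
  qed
  show "?c < m"
  proof (rule ccontr)
    assume "\<not> ?c < m"
    then have nc: "n \<le> ?c" using np by auto
    have "n > 0" using np * by (cases n) auto
    then obtain i where i: "n = Suc i" by (cases n) auto
    obtain t where t: "t \<le> Suc i" "\<And>j. j < t \<Longrightarrow> lb (i - j) = lb i"
      and s: "safe step col K ?c (?c - i) t (lb i) (st (p (Suc i)))"
      using inv[of i] i nc by auto
    have "i < c" using i nc col[OF uv(1)] by auto
    then have "t \<noteq> K" using run[OF t(1)] t(2) i by auto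
    moreover have "?c - i = Suc (?c - Suc i)" using nc i by auto
    ultimately have "col (st v) \<noteq> ?c" using s i np by (auto split: if_splits)
    then show False using * by simp
  qed
qed

section \<open>Relative positions and the transition relation on states\<close>

definition diff :: "nat \<Rightarrow> nat \<Rightarrow> nat \<Rightarrow> nat" where
  "diff k a b = (b + k - a) mod k"

lemma diff_eq: "a < k \<Longrightarrow> b < k \<Longrightarrow> diff k a b = (if a \<le> b then b - a else b + k - a)"
  unfolding diff_def by (auto simp: le_mod_geq)

lemma diff_less: "a < k \<Longrightarrow> b < k \<Longrightarrow> diff k a b < k"
  by (simp add: diff_def)

lemma Suc_mod_eq: "a < k \<Longrightarrow> Suc a mod k = (if Suc a = k then 0 else Suc a)"
  by auto

lemma diff_self: "a < k \<Longrightarrow> diff k a a = 0"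
  by (simp add: diff_def)

lemma diff_Suc_right: "a < k \<Longrightarrow> b < k \<Longrightarrow> diff k a (Suc b mod k) = Suc (diff k a b) mod k"
  by (auto simp: diff_eq Suc_mod_eq)

lemma diff_Suc_self: "a < k \<Longrightarrow> k \<ge> 2 \<Longrightarrow> diff k a (Suc a mod k) = 1"
  by (auto simp: diff_eq Suc_mod_eq)

lemma diff_self_Suc: "a < k \<Longrightarrow> k \<ge> 2 \<Longrightarrow> diff k (Suc a mod k) a = k - 1"
  by (auto simp: diff_eq Suc_mod_eq)

text \<open>The vertex \<open>w @ [i, j]\<close> is described by the type \<open>\<tau> w\<close> of its ring and by the classes of the
  position of the block \<open>i\<close> relative to the last letter of \<open>w\<close> and of \<open>j\<close> relative to \<open>i\<close>.
  The relative positions \<open>0\<close>, \<open>1\<close> and \<open>-1\<close> have the classes \<open>0\<close>, \<open>1\<close> and \<open>2\<close>.\<close>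

definition state :: "nat \<Rightarrow> nat list \<Rightarrow> (nat list \<Rightarrow> nat) \<Rightarrow> nat list \<Rightarrow> nat \<times> nat \<times> nat" where
  "state k W \<tau> u = (\<tau> (butlast (butlast u)),
     W ! diff k (last (0 # butlast (butlast u))) (last (butlast u)),
     W ! diff k (last (butlast u)) (last u))"

lemma state_append [simp]:
  "state k W \<tau> (w @ [i, j]) = (\<tau> w, W ! diff k (last (0 # w)) i, W ! diff k i j)"
  by (simp add: state_def butlast_append)

text \<open>The converse relation; it supplies the backward steps in a block and the reversed links
  between neighbouring rings.\<close>

definition preds :: "nat list list \<Rightarrow> nat list list" where
  "preds R = map (\<lambda>b. filter (\<lambda>a. List.member (R ! a) b) [0..<length R]) [0..<length R]"

lemma in_preds: "a < length R \<Longrightarrow> b < length R \<Longrightarrow> b \<in> set (R ! a) \<Longrightarrow> a \<in> set (preds R ! b)"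
  by (simp add: preds_def)

text \<open>Position class \<open>1\<close> or \<open>2\<close> faces the next or the previous
  block, so crossing changes the block class. Class \<open>0\<close> is the middle vertex
  \<open>w i i\<close>, whose link depends on the last letter of \<open>w\<close>: if it equals
  \<open>i\<close>, the run is longer and \<open>e0\<close> applies; if it is a neighbour of
  \<open>i\<close>, the link goes to a neighbouring ring by \<open>e1\<close> or its converse
  \<open>p1\<close>; otherwise there is none.\<close>

fun step :: "nat list list \<Rightarrow> nat list list \<Rightarrow> nat list list \<Rightarrow> nat list list \<Rightarrow> nat list list \<Rightarrow>
  dir \<Rightarrow> nat \<times> nat \<times> nat \<Rightarrow> (nat \<times> nat \<times> nat) list" where
  "step nx pv e1 p1 e0 Fwd (s, a, b) = map (\<lambda>b'. (s, a, b')) (nx ! b)"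
| "step nx pv e1 p1 e0 Bwd (s, a, b) = map (\<lambda>b'. (s, a, b')) (pv ! b)"
| "step nx pv e1 p1 e0 Cross (s, a, 0) =
     (if a = 0 then map (\<lambda>s'. (s', 0, 0)) (e0 ! s)
      else if a = 1 then map (\<lambda>s'. (s', 2, 0)) (e1 ! s)
      else if a = 2 then map (\<lambda>s'. (s', 1, 0)) (p1 ! s) else [])"
| "step nx pv e1 p1 e0 Cross (s, a, Suc 0) = map (\<lambda>a'. (s, a', 2)) (nx ! a)"
| "step nx pv e1 p1 e0 Cross (s, a, Suc (Suc 0)) = map (\<lambda>a'. (s, a', 1)) (pv ! a)"
| "step nx pv e1 p1 e0 Cross (s, a, Suc (Suc (Suc b))) = []"

fun entry :: "nat list list list \<Rightarrow> nat \<times> nat \<times> nat \<Rightarrow> nat" where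
  "entry tab (s, a, b) = tab ! s ! a ! b"

fun state_safe :: "(dir \<Rightarrow> nat \<times> nat \<times> nat \<Rightarrow> (nat \<times> nat \<times> nat) list) \<Rightarrow> nat list list list \<Rightarrow>
  nat \<Rightarrow> nat \<Rightarrow> nat \<times> nat \<times> nat \<Rightarrow> nat \<Rightarrow> bool" where
  "state_safe st tab K c x q \<longleftrightarrow> 1 \<le> q \<and> q \<le> c \<and>
     list_all (\<lambda>l. list_all (safe st (entry tab) K q q 1 l) (st l x)) [Fwd, Bwd, Cross]"

definition table_safe :: "nat list list \<Rightarrow> nat list list \<Rightarrow> nat list list \<Rightarrow> nat list list list \<Rightarrow>
  nat \<Rightarrow> nat \<Rightarrow> nat list \<Rightarrow> bool" where
  "table_safe nx e1 e0 tab K c tys \<longleftrightarrow>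
     list_all (\<lambda>s. list_all (\<lambda>a. list_all (\<lambda>b.
       state_safe (step nx (preds nx) e1 (preds e1) e0) tab K c (s, a, b) (entry tab (s, a, b)))
       [0..<length nx]) [0..<length nx]) tys"

text \<open>A ring is given by a prefix of length \<open>n - 2\<close>. Links join either
  neighbouring rings, at the blocks \<open>1\<close> and \<open>-1\<close>, or rings whose prefixes
  end in swapped runs, at the blocks \<open>0\<close>; the relations \<open>e1\<close> and
  \<open>e0\<close> govern the two cases. Inclusion is enough because the quotient may have
  additional walks.\<close>

locale ring_typing =
  fixes k n :: nat and W :: "nat list" and nx e1 e0 :: "nat list list" and tys :: "nat list"
    and \<tau> :: "nat list \<Rightarrow> nat"
  assumes k: "k \<ge> 3" and n: "n \<ge> 2"
    and W: "length W = k" "W ! 0 = 0" "W ! 1 = 1" "W ! (k - 1) = 2"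
    and nx: "\<And>i. i < k \<Longrightarrow> W ! i < length nx \<and> W ! (Suc i mod k) \<in> set (nx ! (W ! i))"
    and tys: "\<And>w. length w + 2 = n \<Longrightarrow> set w \<subseteq> {..<k} \<Longrightarrow> \<tau> w \<in> set tys \<and> \<tau> w < length e1"
    and e1: "\<And>w a. length w + 3 = n \<Longrightarrow> set w \<subseteq> {..<k} \<Longrightarrow> a < k \<Longrightarrow>
       \<tau> (w @ [Suc a mod k]) \<in> set (e1 ! \<tau> (w @ [a]))"
    and e0: "\<And>w a m. length w + m + 4 = n \<Longrightarrow> set w \<subseteq> {..<k} \<Longrightarrow> a < k \<Longrightarrow>
       \<tau> (w @ Suc a mod k # replicate (Suc m) a) \<in> set (e0 ! \<tau> (w @ a # replicate (Suc m) (Suc a mod k))) \<and>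
       \<tau> (w @ a # replicate (Suc m) (Suc a mod k)) \<in> set (e0 ! \<tau> (w @ Suc a mod k # replicate (Suc m) a))"
begin

abbreviation "stp \<equiv> step nx (preds nx) e1 (preds e1) e0"

lemma nx_Suc: "i < k \<Longrightarrow> W ! (Suc i mod k) \<in> set (nx ! (W ! i))"
  and pv_Suc: "i < k \<Longrightarrow> W ! i \<in> set (preds nx ! (W ! (Suc i mod k)))"
  and class_less: "i < k \<Longrightarrow> W ! i < length nx"
  using nx[of i] nx[of "Suc i mod k"] by (auto intro: in_preds)

lemma cross_step:
  assumes b: "b = Suc a mod k" and a: "a < k" and w: "set w \<subseteq> {..<k}" and len: "length w + m + 2 = n"
  defines "u \<equiv> w @ a # replicate (Suc m) b" and "v \<equiv> w @ b # replicate (Suc m) a"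
  shows "state k W \<tau> v \<in> set (stp Cross (state k W \<tau> u))"
    and "state k W \<tau> u \<in> set (stp Cross (state k W \<tau> v))"
proof -
  have b': "b < k" "a \<noteq> b" using b a k by (auto simp: Suc_mod_eq)
  have d: "diff k a b = 1" "diff k b a = k - 1" "diff k a a = 0" "diff k b b = 0"
    using a b b' k diff_Suc_self diff_self_Suc diff_self by auto
  have "state k W \<tau> v \<in> set (stp Cross (state k W \<tau> u)) \<and>
        state k W \<tau> u \<in> set (stp Cross (state k W \<tau> v))"
  \<comment> \<open>The length of the run decides: one letter stays in the ring, two letters lead to
    a neighbouring ring through \<open>e1\<close>, longer runs use \<open>e0\<close>.\<close>
  proof (cases m)
    case 0
    \<comment> \<open>For an empty prefix the virtual letter \<open>0\<close> replaces its last
      letter.\<close>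
    let ?h = "last (0 # w)"
    have h: "?h < k" using w k by (cases w rule: rev_cases) auto
    have "u = w @ [a, b]" "v = w @ [b, a]" using 0 by (auto simp: u_def v_def)
    moreover have "diff k ?h b = Suc (diff k ?h a) mod k" using diff_Suc_right h a b by simp
    ultimately show ?thesis
      using d W nx_Suc[of "diff k ?h a"] pv_Suc[of "diff k ?h a"] diff_less[OF h a]
      by (auto simp: numeral_2_eq_2)
  next
    case (Suc m')
    show ?thesis
    proof (cases m')
      case 0
      have uv: "u = (w @ [a]) @ [b, b]" "v = (w @ [b]) @ [a, a]"
        using Suc 0 by (auto simp: u_def v_def)
      have len': "length w + 3 = n" using len Suc 0 by simp
      have "\<tau> (w @ [a]) < length e1" "\<tau> (w @ [b]) < length e1"
        using tys[of "w @ [a]"] tys[of "w @ [b]"] len' w a b' by auto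
      then show ?thesis
        using d W e1[OF len' w a] b unfolding uv state_append by (auto intro: in_preds)
    next
      case (Suc m'')
      have uv: "u = (w @ a # replicate (Suc m'') b) @ [b, b]"
          "v = (w @ b # replicate (Suc m'') a) @ [a, a]"
        using Suc \<open>m = Suc m'\<close> by (auto simp: u_def v_def replicate_app_Cons_same)
      have len': "length w + m'' + 4 = n" using len Suc \<open>m = Suc m'\<close> by simp
      show ?thesis
        using d W e0[OF len' w a] b unfolding uv state_append by (auto simp: last_replicate)
    qed
  qed
  then show "state k W \<tau> v \<in> set (stp Cross (state k W \<tau> u))"
    and "state k W \<tau> u \<in> set (stp Cross (state k W \<tau> v))" by auto
qed

lemma fwd_step:
  assumes "w @ [a] \<in> sierp_verts k n" "a < k"
  shows "state k W \<tau> (w @ [Suc a mod k]) \<in> set (stp Fwd (state k W \<tau> (w @ [a])))"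
    and "state k W \<tau> (w @ [a]) \<in> set (stp Bwd (state k W \<tau> (w @ [Suc a mod k])))"
proof -
  have "w \<noteq> []" using assms(1) n by (auto simp: sierp_verts_def)
  then obtain w' i where w: "w = w' @ [i]" by (metis rev_exhaust)
  then have i: "i < k" using assms(1) by (auto simp: sierp_verts_def)
  have eq: "w @ [x] = w' @ [i, x]" for x using w by simp
  show "state k W \<tau> (w @ [Suc a mod k]) \<in> set (stp Fwd (state k W \<tau> (w @ [a])))"
    and "state k W \<tau> (w @ [a]) \<in> set (stp Bwd (state k W \<tau> (w @ [Suc a mod k])))"
    using nx_Suc pv_Suc diff_less[OF i assms(2)] diff_Suc_right[OF i assms(2)]
    unfolding eq state_append by auto
qed

lemma edge_step:
  assumes "u \<in> sierp_verts k n" "v \<in> sierp_verts k n" "edge k l u v"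
  shows "state k W \<tau> v \<in> set (stp l (state k W \<tau> u))"
proof (cases l)
  case Fwd
  then show ?thesis using assms fwd_step(1) by auto
next
  case Bwd
  then show ?thesis using assms fwd_step(2) by auto
next
  case Cross
  then obtain w a b m where *: "a \<noteq> b" "cycle_adj k a b" "u = w @ a # replicate (Suc m) b"
      "v = w @ b # replicate (Suc m) a"
    using assms(3) unfolding Cross edge.simps by blast
  have w: "set w \<subseteq> {..<k}" "length w + m + 2 = n"
    using assms(1) * by (auto simp: sierp_verts_def)
  have "b = Suc a mod k \<or> a = Suc b mod k" "a < k" "b < k" using * by (auto simp: cycle_adj_def)
  then show ?thesis
    using cross_step(1)[of b a w m] cross_step(2)[of a b w m] w * Cross by blast
qed

lemma state_mem:
  assumes "u \<in> sierp_verts k n"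
  obtains s a b where "state k W \<tau> u = (s, a, b)" "s \<in> set tys" "a < length nx" "b < length nx"
proof -
  have u: "length u \<ge> 2" "set u \<subseteq> {..<k}" "length u = n"
    using assms n by (auto simp: sierp_verts_def)
  obtain u' j where 1: "u = u' @ [j]" using u by (cases u rule: rev_cases) auto
  obtain w i where 2: "u' = w @ [i]" using u 1 by (cases u' rule: rev_cases) auto
  have eq: "u = w @ [i, j]" using 1 2 by simp
  have h: "last (0 # w) < k" using u eq k by (cases w rule: rev_cases) auto
  show ?thesis
    using that[of "\<tau> w" "W ! diff k (last (0 # w)) i" "W ! diff k i j"] tys[of w] u
      class_less[OF diff_less[OF h, of i]] class_less[OF diff_less[of i k j]]
    unfolding eq by auto
qed

theorem table_safe_imp_packing_coloring:
  assumes "table_safe nx e1 e0 tab K c tys" "K = k \<or> c < K"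
  shows "packing_coloring (sierp_verts k n) (sierp_adj (cycle_adj k)) c (\<lambda>u. entry tab (state k W \<tau> u))"
proof (rule packing_coloring_of_states[where K = K and step = stp, OF _ assms(2) edge_step refl])
  show "k \<ge> 2" using k by simp
  have "state_safe stp tab K c (state k W \<tau> u) (entry tab (state k W \<tau> u))"
    if "u \<in> sierp_verts k n" for u
    using state_mem[OF that] assms(1) unfolding table_safe_def list_all_iff
    by (metis atLeastLessThan_iff le0 set_upt)
  note safe = this
  show "entry tab (state k W \<tau> u) \<in> {1..c}" if "u \<in> sierp_verts k n" for u
    using safe[OF that] by auto
  show "safe stp (entry tab) K (entry tab (state k W \<tau> u)) (entry tab (state k W \<tau> u)) 1 l y"
    if "u \<in> sierp_verts k n" "y \<in> set (stp l (state k W \<tau> u))" for u l y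
    using safe[OF that(1)] that(2) by (cases l) (auto simp: list_all_iff)
qed

end

subsection \<open>Ring types\<close>

definition position_classes :: "nat \<Rightarrow> nat list \<Rightarrow> nat list list \<Rightarrow> bool" where
  "position_classes k W R \<longleftrightarrow> k \<ge> 3 \<and> length W = k \<and> W ! 0 = 0 \<and> W ! 1 = 1 \<and> W ! (k - 1) = 2 \<and>
     (\<forall>i<k. W ! i < length R \<and> W ! (Suc i mod k) \<in> set (R ! (W ! i)))"

text \<open>Appending the class \<open>0\<close> of the first position turns the cyclic condition
  into one on a plain list, including the step from \<open>k - 1\<close> back to
  \<open>0\<close>.\<close>

lemma position_classesI:
  assumes "successively (\<lambda>x y. x < length R \<and> y \<in> set (R ! x)) (W @ [0])"
    and "W = 0 # 1 # W'" "W' \<noteq> []" "last W = 2" "length W = k"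
  shows "position_classes k W R"
proof -
  have "W ! 0 = 0" using assms(2) by simp
  have "W ! i < length R \<and> W ! (Suc i mod k) \<in> set (R ! (W ! i))" if "i < k" for i
  proof -
    have "(W @ [0]) ! Suc i = W ! (Suc i mod k)"
      using that assms(5) \<open>W ! 0 = 0\<close> by (cases "Suc i = k") (simp_all add: nth_append)
    then show ?thesis
      using assms(1,5) that unfolding successively_conv_nth by (auto simp: nth_append)
  qed
  then show ?thesis
    using assms(2-5) last_conv_nth[of W] unfolding position_classes_def
    by (auto simp: Suc_le_eq)
qed

text \<open>The segment closes on itself through the pair \<open>(6, 3)\<close>, so this pair and a
  single pass cover any number of repetitions.\<close>

lemma position_classes_loop:
  assumes "successively (\<lambda>x y. x < length R \<and> y \<in> set (R ! x)) ([0, 1, 3, 4, 5, 6] @ suf @ [0])"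
    and "6 < length R \<and> 3 \<in> set (R ! 6)" "suf \<noteq> []" "last suf = 2"
  shows "position_classes (6 + 4 * m + length suf)
           ([0, 1] @ concat (replicate (Suc m) [3, 4, 5, 6]) @ suf) R"
proof -
  let ?P = "\<lambda>x y. x < length R \<and> y \<in> set (R ! x)"
  have "successively ?P (6 # concat (replicate m [3, 4, 5, 6]) @ suf @ [0])"
  proof (induction m)
    case 0
    then show ?case using assms(1) by simp
  next
    case (Suc m)
    then show ?case using assms(1,2) by simp
  qed
  then have "successively ?P (([0, 1] @ concat (replicate (Suc m) [3, 4, 5, 6]) @ suf) @ [0])"
    using assms(1) by simp
  then show ?thesis
    by (rule position_classesI[where W' = "concat (replicate (Suc m) [3, 4, 5, 6]) @ suf"])
      (use assms(3,4) in \<open>auto simp: length_concat sum_list_replicate\<close>)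
qed

text \<open>Words of length two form a single ring with empty prefix, so there are no links between
  rings.\<close>

lemma ring_typing_two:
  assumes "position_classes k W R"
  shows "ring_typing k 2 W R [[]] [[]] [0] (\<lambda>_. 0)"
  using assms by unfold_locales (auto simp: position_classes_def)

text \<open>For even \<open>k\<close> the step from \<open>k - 1\<close> to \<open>0\<close> changes
  the parity too, so every link flips the type.\<close>

lemma ring_typing_even:
  assumes "position_classes k W R" "even k" "n \<ge> 2"
  shows "ring_typing k n W R [[1], [0]] [[1], [0]] [0, 1] (\<lambda>w. last (0 # w) mod 2)"
proof
  have parity: "Suc a mod k mod 2 = Suc a mod 2" for a
    using assms(2) by (simp add: mod_mod_cancel)
  show "last (0 # w @ [Suc a mod k]) mod 2 \<in> set ([[1], [0]] ! (last (0 # w @ [a]) mod 2))"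
    for w and a :: nat
    using parity[of a] by (cases "even a") (auto simp: mod2_eq_if)
  show "last (0 # w @ Suc a mod k # replicate (Suc m) a) mod 2
         \<in> set ([[1], [0]] ! (last (0 # w @ a # replicate (Suc m) (Suc a mod k)) mod 2)) \<and>
       last (0 # w @ a # replicate (Suc m) (Suc a mod k)) mod 2
         \<in> set ([[1], [0]] ! (last (0 # w @ Suc a mod k # replicate (Suc m) a) mod 2))"
    for w m and a :: nat
    using parity[of a]
    by (cases "even a") (auto simp: mod2_eq_if last_replicate split: if_splits)
qed (use assms in \<open>auto simp: position_classes_def mod2_eq_if\<close>)

text \<open>Words are read backwards and start with a virtual letter \<open>0\<close>. Since an odd cycle has no
  alternating parity \<open>T\<close>, in every ring family one parity step is suppressed: normally it is the
  one after position \<open>2\<close>, and the flag \<open>S\<close> marks the words ending there, whose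
  own family suppresses the step from position \<open>0\<close> to \<open>1\<close> instead.\<close>

fun ring_state :: "nat \<Rightarrow> nat list \<Rightarrow> bool \<times> bool" where
  "ring_state k [] = (False, False)"
| "ring_state k (b # w) = (let q = diff k (hd (w @ [0])) b; (T, S) = ring_state k w in
     if q = 0 then (T, S)
     else if S then (T \<noteq> even q, False)
     else (T \<noteq> (odd q \<noteq> (2 < q)), q = 2))"

locale odd_cycle =
  fixes k :: nat
  assumes odd: "odd k" and k: "k \<ge> 5"
begin

lemma hd_less: "set w \<subseteq> {..<k} \<Longrightarrow> hd (w @ [0]) < k"
  using k by (cases w) auto

text \<open>The flag announces that the next step is the suppressed one: it sits at position
  \<open>2\<close>, or at position \<open>0\<close> if it is inherited from the shorter
  word.\<close>

lemma ring_state_next: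
  assumes "set w \<subseteq> {..<k}" "a < k"
    and "ring_state k (a # w) = (T, S)" "ring_state k (Suc a mod k # w) = (T', S')"
  shows "if S then T' = T \<and> \<not> S' else T' \<noteq> T"
proof -
  define q where "q = diff k (hd (w @ [0])) a"
  have q: "q < k" "diff k (hd (w @ [0])) (Suc a mod k) = Suc q mod k"
    using diff_less diff_Suc_right hd_less assms(1,2) unfolding q_def by auto
  obtain T0 S0 where s: "ring_state k w = (T0, S0)" by fastforce
  have eqs: "(T, S) = (if q = 0 then (T0, S0) else if S0 then (T0 \<noteq> even q, False)
        else (T0 \<noteq> (odd q \<noteq> (2 < q)), q = 2))"
      "(T', S') = (if Suc q mod k = 0 then (T0, S0) else if S0 then (T0 \<noteq> even (Suc q mod k), False)
        else (T0 \<noteq> (odd (Suc q mod k) \<noteq> (2 < Suc q mod k)), Suc q mod k = 2))"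
    using assms(3,4) q(2) s unfolding q_def[symmetric] by (auto simp: Let_def q_def)
  consider "Suc q = k" | "Suc q < k" using q(1) by linarith
  then show ?thesis
  proof cases
    case 1
    \<comment> \<open>Under both rules the last position has the type opposite to position
      \<open>0\<close>, because \<open>k - 1\<close> is even and greater than
      \<open>2\<close>.\<close>
    then have "even q" "2 < q" "q \<noteq> 0" using odd k by auto
    then show ?thesis using eqs 1 by (auto split: if_splits)
  next
    case 2
    then show ?thesis using eqs by (auto split: if_splits)
  qed
qed

lemma ring_state_replicate:
  "b < k \<Longrightarrow> ring_state k (replicate (Suc m) b @ w) = ring_state k (b # w)"
  by (induction m) (auto simp: diff_self split: prod.split)

text \<open>The run is entered at relative position \<open>1\<close> after \<open>a\<close> and at
  \<open>k - 1\<close> after \<open>b\<close>. The latter always flips the type; the former flips it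
  unless \<open>a\<close> is flagged, which is exactly when \<open>a\<close> and \<open>b\<close>
  have equal types. So the results are opposite in either case, and repeating a letter changes
  nothing.\<close>

lemma ring_state_swap:
  assumes "set w \<subseteq> {..<k}" "a < k" "b = Suc a mod k"
  shows "\<exists>T. ring_state k (replicate (Suc m) b @ a # w) = (T, False) \<and>
             ring_state k (replicate (Suc m) a @ b # w) = (\<not> T, False)"
proof -
  obtain T S T' S' where s: "ring_state k (a # w) = (T, S)" "ring_state k (b # w) = (T', S')"
    by fastforce
  have b: "b < k" using assms(2,3) by simp
  have d: "diff k a b = 1" "diff k b a = k - 1"
    using diff_Suc_self diff_self_Suc assms(2,3) k by auto
  have e: "even (k - 1)" "k - 1 \<noteq> 0" "k - 1 > 2" using odd k by auto
  have "ring_state k (b # a # w) = (if S then T else \<not> T, False)"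
    using s(1) d by (subst ring_state.simps) (auto simp: Let_def)
  moreover have "ring_state k (a # b # w) = (\<not> T', False)"
    using s(2) d e by (subst ring_state.simps) (auto simp: Let_def)
  moreover have "if S then T' = T \<and> \<not> S' else T' \<noteq> T"
    using ring_state_next assms s by blast
  ultimately show ?thesis
    using ring_state_replicate[OF b, of m "a # w"] ring_state_replicate[OF assms(2), of m "b # w"]
    by (auto split: if_splits)
qed

end

fun ring_code :: "bool \<times> bool \<Rightarrow> nat" where
  "ring_code (T, S) = of_bool T + 2 * of_bool S"

text \<open>An unflagged code leads to the opposite type with either flag, a flagged one to the same
  type unflagged. Flagged codes do not occur at swapped runs, hence the empty entries.\<close>

lemma ring_typing_odd:
  assumes "position_classes k W R" "odd k" "k \<ge> 5" "n \<ge> 2"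
  shows "ring_typing k n W R [[1, 3], [0, 2], [0], [1]] [[1], [0], [], []] [0, 1, 2, 3]
           (\<lambda>w. ring_code (ring_state k (rev w)))"
proof -
  interpret odd_cycle k using assms by unfold_locales
  show ?thesis
  proof
    fix w assume "set w \<subseteq> {..<k}"
    obtain T S where "ring_state k (rev w) = (T, S)" by fastforce
    then show "ring_code (ring_state k (rev w)) \<in> set [0, 1, 2, 3] \<and>
        ring_code (ring_state k (rev w)) < length [[1::nat, 3], [0, 2], [0], [1]]"
      by (auto simp: of_bool_def)
  next
    fix w :: "nat list" and a assume wa: "set w \<subseteq> {..<k}" "a < k"
    obtain T S T' S' where s: "ring_state k (a # rev w) = (T, S)"
        "ring_state k (Suc a mod k # rev w) = (T', S')"
      by fastforce
    have "if S then T' = T \<and> \<not> S' else T' \<noteq> T"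
      by (rule ring_state_next[OF _ wa(2) s]) (use wa in simp)
    then show "ring_code (ring_state k (rev (w @ [Suc a mod k])))
        \<in> set ([[1, 3], [0, 2], [0], [1]] ! ring_code (ring_state k (rev (w @ [a]))))"
      using s by (cases T; cases S; cases T'; cases S') (simp_all del: ring_state.simps)
  next
    fix w :: "nat list" and a m assume wa: "set w \<subseteq> {..<k}" "a < k"
    obtain T where "ring_state k (replicate (Suc m) (Suc a mod k) @ a # rev w) = (T, False)"
        "ring_state k (replicate (Suc m) a @ (Suc a mod k) # rev w) = (\<not> T, False)"
      using ring_state_swap[of "rev w" a "Suc a mod k" m] wa by auto
    then show "ring_code (ring_state k (rev (w @ Suc a mod k # replicate (Suc m) a)))
         \<in> set ([[1], [0], [], []] ! ring_code (ring_state k (rev (w @ a # replicate (Suc m) (Suc a mod k))))) \<and>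
       ring_code (ring_state k (rev (w @ a # replicate (Suc m) (Suc a mod k))))
         \<in> set ([[1], [0], [], []] ! ring_code (ring_state k (rev (w @ Suc a mod k # replicate (Suc m) a))))"
      by (cases T) (simp_all del: ring_state.simps replicate.simps)
  qed (use assms in \<open>auto simp: position_classes_def\<close>)
qed

text \<open>For five letters the type also records the relative position of the last letter. Only
  the positions \<open>0\<close> and \<open>2\<close> can carry the flag, so the five positions need
  4, 2, 4, 2 and 2 codes, and the offsets are their partial sums. The empty word counts as position
  \<open>0\<close>.\<close>

definition ring_code_5 :: "nat list \<Rightarrow> nat" where
  "ring_code_5 w = (case w of [] \<Rightarrow> 0 | b # v \<Rightarrow>
     [0, 4, 6, 10, 12] ! diff 5 (hd (v @ [0])) b + ring_code (ring_state 5 w))"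

abbreviation links_5 :: "nat list list" where
  "links_5 \<equiv> [[5], [4], [4], [5], [7, 9], [6, 8], [11], [10], [10], [11], [13], [12], [1, 3], [0, 2]]"

abbreviation swaps_5 :: "nat list list" where
  "swaps_5 \<equiv> [[1], [0], [], [], [13], [12], [], [], [], [], [], [], [5], [4]]"

lemma ring_state_flag:
  "ring_state k (b # w) = (T, True) \<Longrightarrow> diff k (hd (w @ [0])) b \<in> {0, 2}"
  by (auto simp: Let_def split: prod.splits if_splits)

lemma less_5: "q < (5::nat) \<longleftrightarrow> q \<in> {0, 1, 2, 3, 4}"
  by auto

lemma ring_typing_5:
  assumes "position_classes 5 W R" "n \<ge> 2"
  shows "ring_typing 5 n W R links_5 swaps_5 [0..<14] (\<lambda>w. ring_code_5 (rev w))"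
proof -
  interpret odd_cycle 5 by unfold_locales simp_all
  have code: "ring_code_5 (a # w) = [0, 4, 6, 10, 12] ! q + of_bool T + 2 * of_bool S"
    if "ring_state 5 (a # w) = (T, S)" "q = diff 5 (hd (w @ [0])) a" for a w q T S
    using that by (simp add: ring_code_5_def del: ring_state.simps)
  show ?thesis
  proof
    fix w :: "nat list" assume w: "set w \<subseteq> {..<5}"
    show "ring_code_5 (rev w) \<in> set [0..<14] \<and> ring_code_5 (rev w) < length links_5"
    proof (cases "rev w")
      case Nil
      then show ?thesis by (simp add: ring_code_5_def)
    next
      case (Cons b v)
      have bv: "b < 5" "set v \<subseteq> {..<5}"
        using w arg_cong[OF Cons, of set] by auto
      obtain T S where s: "ring_state 5 (b # v) = (T, S)" by fastforce
      define q where "q = diff 5 (hd (v @ [0])) b"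
      have "q < 5" unfolding q_def using diff_less hd_less bv by auto
      moreover have "S \<Longrightarrow> q \<in> {0, 2}" using ring_state_flag s unfolding q_def by metis
      ultimately show ?thesis
        unfolding Cons code[OF s q_def] less_5 by (cases T; cases S) auto
    qed
  next
    fix w :: "nat list" and a assume wa: "set w \<subseteq> {..<5}" "a < (5::nat)"
    obtain T S T' S' where s: "ring_state 5 (a # rev w) = (T, S)"
        "ring_state 5 (Suc a mod 5 # rev w) = (T', S')"
      by fastforce
    define q where "q = diff 5 (hd (rev w @ [0])) a"
    have h: "hd (rev w @ [0]) < 5" using hd_less[of "rev w"] wa by simp
    have q': "Suc q mod 5 = diff 5 (hd (rev w @ [0])) (Suc a mod 5)"
      unfolding q_def using diff_Suc_right[OF h wa(2)] by simp
    have "q < 5" unfolding q_def using diff_less[OF h wa(2)] .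
    moreover have "S \<Longrightarrow> q \<in> {0, 2}" using ring_state_flag s(1) unfolding q_def by metis
    moreover have "S' \<Longrightarrow> Suc q mod 5 \<in> {0, 2}" using ring_state_flag s(2) unfolding q' by metis
    moreover have "if S then T' = T \<and> \<not> S' else T' \<noteq> T"
      by (rule ring_state_next[OF _ wa(2) s]) (use wa in simp)
    moreover have "\<not> 5 dvd Suc (Suc 0)" by presburger
    ultimately show "ring_code_5 (rev (w @ [Suc a mod 5])) \<in> set (links_5 ! ring_code_5 (rev (w @ [a])))"
      unfolding rev_append rev.simps append.simps code[OF s(1) q_def] code[OF s(2) q'] less_5
      by (cases T; cases T'; cases S; cases S') auto
  next
    fix w :: "nat list" and a m :: nat assume wa: "set w \<subseteq> {..<5}" "a < (5::nat)"
    let ?b = "Suc a mod 5"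
    \<comment> \<open>A run of a single letter ends at relative position \<open>1\<close> or
      \<open>4\<close>; in a longer run the preceding letter is the same, which gives
      \<open>0\<close>.\<close>
    let ?q = "if m = 0 then 1 else 0" and ?q' = "if m = 0 then 4 else (0::nat)"
    obtain T where T: "ring_state 5 (?b # replicate m ?b @ a # rev w) = (T, False)"
        "ring_state 5 (a # replicate m a @ ?b # rev w) = (\<not> T, False)"
      using ring_state_swap[of "rev w" a ?b m] wa by auto
    have q: "?q = diff 5 (hd ((replicate m ?b @ a # rev w) @ [0])) ?b"
            "?q' = diff 5 (hd ((replicate m a @ ?b # rev w) @ [0])) a"
      using diff_Suc_self[OF wa(2)] diff_self_Suc[OF wa(2)] diff_self wa(2) by (cases m; simp)+
    have rev: "rev (w @ x # replicate (Suc m) y) = y # replicate m y @ x # rev w" for x y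
      by (simp add: replicate_append_same)
    show "ring_code_5 (rev (w @ ?b # replicate (Suc m) a))
         \<in> set (swaps_5 ! ring_code_5 (rev (w @ a # replicate (Suc m) ?b))) \<and>
       ring_code_5 (rev (w @ a # replicate (Suc m) ?b))
         \<in> set (swaps_5 ! ring_code_5 (rev (w @ ?b # replicate (Suc m) a)))"
      unfolding rev code[OF T(1) q(1)] code[OF T(2) q(2)] by (cases T) auto
  qed (use assms in \<open>auto simp: position_classes_def\<close>)
qed

subsection \<open>Colour tables\<close>

text \<open>A table \<open>colours_k\<close> lists the colours by ring type, block class and position class; the relation
  \<open>succs_k\<close> contains the pairs of classes of cyclically consecutive positions. The class lists of the
  families for \<open>k = 8, 10, 11, 13 + 4m\<close> repeat the segment \<open>[3, 4, 5, 6]\<close>. The tables were found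
  by a SAT solver.\<close>

definition succs_4 :: "nat list list" where
  "succs_4 =
    [[1], [3], [0], [2]]"

definition succs_5 :: "nat list list" where
  "succs_5 =
    [[1], [3], [0], [4], [2]]"

definition succs_6 :: "nat list list" where
  "succs_6 =
    [[1], [3], [0], [4], [5], [2]]"

definition succs_7 :: "nat list list" where
  "succs_7 =
    [[1], [3], [0], [4], [5], [6], [2]]"

definition succs_8 :: "nat list list" where
  "succs_8 =
    [[1], [3], [0], [4], [5], [6], [7, 3], [2]]"

definition succs_9 :: "nat list list" where
  "succs_9 =
    [[1], [3], [0], [4], [5], [6], [7], [8], [2]]"

definition succs_10 :: "nat list list" where
  "succs_10 =
    [[1], [3], [0], [4], [5], [6], [7, 3], [8], [9], [2]]"

definition succs_11 :: "nat list list" where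
  "succs_11 =
    [[1], [3], [0], [4], [5], [6], [7, 3], [8], [9], [10], [2]]"

definition succs_13 :: "nat list list" where
  "succs_13 =
    [[1], [3], [0], [4], [5], [6], [7, 3], [8], [9], [10], [11], [12], [2]]"

definition colours_two_4 :: "nat list list list" where
  "colours_two_4 =
    [[[1, 3, 2, 1], [1, 4, 2, 1], [1, 4, 2, 1], [1, 3, 2, 1]]]"

lemma colours_two_4_safe: "table_safe succs_4 [[]] [[]] colours_two_4 4 4 [0]"
  by code_simp

definition colours_two_6 :: "nat list list list" where
  "colours_two_6 =
    [[[4, 1, 2, 2, 1, 3], [1, 2, 3, 4, 1, 2], [1, 5, 2, 1, 3, 1], [3, 1, 1, 2, 1, 5], [1, 5, 4,
    1, 2, 1], [1, 4, 3, 1, 2, 1]]]"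

lemma colours_two_6_safe: "table_safe succs_6 [[]] [[]] colours_two_6 6 5 [0]"
  by code_simp

definition colours_two_7 :: "nat list list list" where
  "colours_two_7 =
    [[[4, 1, 1, 2, 5, 1, 3], [2, 1, 3, 4, 1, 2, 1], [1, 2, 5, 1, 3, 2, 1], [2, 1, 5, 3, 1, 2,
    1], [2, 1, 4, 3, 1, 2, 1], [2, 1, 5, 3, 1, 2, 1], [2, 1, 4, 3, 1, 2, 1]]]"

lemma colours_two_7_safe: "table_safe succs_7 [[]] [[]] colours_two_7 7 5 [0]"
  by code_simp

definition colours_two_8 :: "nat list list list" where
  "colours_two_8 =
    [[[1, 3, 2, 1, 2, 1, 3, 1], [4, 1, 1, 2, 1, 3, 1, 2], [4, 1, 1, 3, 1, 2, 1, 3], [1, 2, 3,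
    1, 3, 1, 2, 1], [4, 1, 1, 3, 1, 2, 1, 3], [1, 3, 2, 1, 2, 1, 3, 1], [4, 1, 1, 2, 1, 3, 1,
    2], [1, 2, 3, 1, 3, 1, 2, 1]]]"

lemma colours_two_8_safe: "table_safe succs_8 [[]] [[]] colours_two_8 8 4 [0]"
  by code_simp

definition colours_two_10 :: "nat list list list" where
  "colours_two_10 =
    [[[1, 2, 3, 1, 3, 1, 2, 4, 1, 2], [4, 1, 1, 2, 1, 3, 1, 2, 1, 3], [4, 1, 1, 2, 1, 3, 1, 2,
    1, 3], [1, 2, 3, 1, 3, 1, 2, 4, 1, 2], [4, 1, 1, 2, 1, 3, 1, 2, 1, 3], [1, 2, 3, 1, 3, 1,
    2, 4, 1, 2], [4, 1, 1, 2, 1, 3, 1, 2, 1, 3], [1, 2, 3, 1, 3, 1, 2, 4, 1, 2], [4, 1, 1, 2,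
    1, 3, 1, 2, 1, 3], [1, 2, 3, 1, 3, 1, 2, 4, 1, 2]]]"

lemma colours_two_10_safe: "table_safe succs_10 [[]] [[]] colours_two_10 8 4 [0]"
  by code_simp

definition colours_4 :: "nat list list list" where
  "colours_4 =
    [[[4, 1, 1, 3], [1, 3, 2, 1], [1, 2, 3, 1], [1, 4, 2, 1]], [[1, 2, 3, 1], [5, 1, 1, 3], [5,
    2, 4, 1], [1, 3, 2, 1]]]"

lemma colours_4_safe: "table_safe succs_4 [[1], [0]] [[1], [0]] colours_4 4 5 [0, 1]"
  by code_simp

definition colours_6 :: "nat list list list" where
  "colours_6 =
    [[[3, 1, 1, 5, 1, 6], [1, 4, 2, 1, 3, 1], [1, 2, 3, 4, 1, 2], [1, 3, 2, 6, 1, 5], [1, 5, 2,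
    3, 1, 4], [4, 1, 2, 2, 6, 1]], [[1, 4, 2, 2, 3, 1], [5, 1, 1, 2, 1, 3], [3, 1, 6, 5, 2, 1],
    [1, 6, 3, 1, 2, 1], [1, 5, 4, 1, 2, 1], [1, 2, 3, 1, 4, 1]]]"

lemma colours_6_safe: "table_safe succs_6 [[1], [0]] [[1], [0]] colours_6 6 6 [0, 1]"
  by code_simp

definition colours_8 :: "nat list list list" where
  "colours_8 =
    [[[5, 1, 1, 2, 1, 3, 1, 2], [1, 2, 3, 1, 3, 1, 2, 1], [1, 3, 2, 1, 2, 1, 3, 1], [3, 1, 1,
    2, 1, 3, 1, 5], [2, 5, 4, 1, 2, 1, 3, 1], [3, 1, 1, 2, 1, 3, 1, 2], [1, 2, 4, 1, 3, 1, 2,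
    1], [5, 1, 1, 3, 1, 2, 1, 3]], [[1, 3, 2, 1, 2, 1, 3, 1], [4, 1, 1, 2, 1, 3, 1, 2], [4, 1,
    1, 3, 1, 2, 1, 5], [1, 5, 3, 1, 3, 1, 2, 1], [1, 4, 2, 1, 2, 1, 3, 1], [1, 5, 3, 1, 3, 1,
    2, 1], [4, 1, 1, 2, 1, 3, 1, 2], [1, 2, 3, 1, 3, 1, 2, 1]]]"

lemma colours_8_safe: "table_safe succs_8 [[1], [0]] [[1], [0]] colours_8 8 5 [0, 1]"
  by code_simp

definition colours_10 :: "nat list list list" where
  "colours_10 =
    [[[4, 1, 1, 2, 1, 3, 1, 2, 1, 3], [1, 2, 3, 1, 3, 1, 2, 4, 1, 2], [1, 2, 3, 1, 3, 1, 2, 4,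
    1, 2], [1, 3, 4, 1, 2, 1, 3, 1, 2, 1], [1, 5, 2, 2, 1, 3, 1, 2, 4, 1], [1, 3, 4, 1, 2, 1,
    3, 1, 2, 1], [1, 5, 2, 3, 1, 2, 1, 3, 4, 1], [1, 3, 4, 1, 2, 1, 3, 1, 2, 1], [1, 5, 2, 2,
    1, 3, 1, 2, 4, 1], [4, 1, 1, 2, 1, 3, 1, 2, 1, 3]], [[1, 2, 3, 1, 3, 1, 2, 4, 1, 2], [5, 1,
    1, 2, 1, 3, 1, 2, 1, 3], [5, 1, 1, 2, 1, 3, 1, 2, 1, 3], [1, 2, 3, 1, 3, 1, 2, 4, 1, 2],
    [4, 1, 1, 2, 1, 3, 1, 2, 1, 5], [1, 2, 3, 1, 3, 1, 2, 1, 5, 1], [5, 1, 4, 2, 1, 3, 1, 2, 1,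
    3], [1, 4, 3, 2, 1, 3, 1, 4, 1, 2], [5, 1, 1, 2, 1, 3, 1, 2, 1, 3], [1, 4, 3, 1, 2, 1, 3,
    1, 2, 1]]]"

lemma colours_10_safe: "table_safe succs_10 [[1], [0]] [[1], [0]] colours_10 8 5 [0, 1]"
  by code_simp

definition colours_5 :: "nat list list list" where
  "colours_5 =
    [[[1, 2, 6, 3, 1], [1, 3, 5, 2, 1], [2, 1, 5, 3, 1], [2, 1, 4, 6, 1], [2, 1, 3, 4, 1]],
    [[4, 2, 1, 1, 3], [5, 2, 1, 1, 3], [5, 2, 1, 1, 3], [3, 2, 1, 1, 4], [1, 2, 6, 4, 1]], [[1,
    2, 3, 4, 1], [5, 2, 1, 1, 3], [2, 1, 1, 5, 6], [3, 1, 1, 2, 6], [1, 3, 4, 2, 1]], [[1, 4,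
    2, 1, 6], [1, 5, 3, 2, 1], [5, 1, 2, 3, 1], [2, 6, 1, 1, 3], [3, 1, 1, 4, 2]], [[6, 1, 1,
    3, 2], [4, 1, 2, 3, 1], [1, 4, 3, 2, 1], [1, 5, 2, 3, 1], [1, 2, 6, 1, 4]], [[1, 5, 3, 2,
    1], [2, 4, 1, 1, 3], [2, 1, 1, 4, 6], [3, 5, 1, 1, 2], [1, 3, 2, 1, 4]], [[4, 1, 1, 5, 2],
    [6, 1, 2, 3, 1], [1, 3, 6, 2, 1], [1, 4, 2, 3, 1], [1, 2, 5, 3, 1]], [[2, 1, 1, 4, 6], [1,
    5, 3, 2, 1], [1, 3, 5, 2, 1], [4, 1, 1, 2, 3], [3, 1, 6, 2, 1]], [[2, 1, 1, 3, 4], [1, 3,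
    5, 1, 2], [1, 6, 3, 1, 2], [2, 1, 1, 6, 4], [2, 1, 5, 4, 1]], [[1, 3, 2, 4, 1], [6, 1, 1,
    5, 2], [1, 5, 2, 3, 1], [1, 4, 3, 2, 1], [3, 1, 1, 6, 2]], [[3, 1, 1, 5, 2], [1, 3, 2, 6,
    1], [2, 4, 1, 1, 3], [5, 4, 1, 1, 2], [2, 6, 1, 1, 3]], [[3, 1, 1, 2, 5], [2, 1, 4, 3, 1],
    [1, 2, 4, 1, 3], [2, 1, 6, 4, 1], [1, 2, 3, 1, 5]], [[2, 1, 1, 6, 4], [1, 4, 3, 1, 2], [1,
    3, 5, 1, 2], [1, 6, 2, 3, 1], [4, 1, 2, 3, 1]], [[2, 1, 5, 3, 1], [1, 3, 4, 1, 2], [4, 1,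
    1, 2, 3], [1, 4, 2, 5, 1], [1, 2, 3, 1, 6]]]"

lemma colours_5_safe: "table_safe succs_5 links_5 swaps_5 colours_5 5 6 [0..<14]"
  by code_simp

definition colours_7 :: "nat list list list" where
  "colours_7 =
    [[[1, 2, 3, 1, 4, 2, 1], [6, 1, 1, 2, 4, 1, 3], [2, 1, 1, 4, 1, 2, 5], [1, 5, 3, 4, 1, 2,
    1], [1, 6, 2, 1, 2, 1, 3], [3, 1, 4, 5, 1, 2, 1], [1, 3, 2, 1, 2, 4, 1]], [[5, 2, 1, 1, 3,
    1, 2], [6, 1, 1, 4, 1, 2, 3], [1, 4, 2, 1, 2, 3, 1], [1, 3, 2, 1, 2, 5, 1], [2, 1, 4, 3, 1,
    2, 1], [2, 1, 6, 3, 1, 2, 1], [5, 1, 4, 3, 1, 2, 1]], [[2, 1, 5, 4, 1, 2, 1], [1, 6, 3, 4,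
    1, 2, 1], [2, 1, 1, 3, 1, 2, 4], [2, 1, 1, 3, 1, 2, 5], [2, 1, 4, 3, 1, 2, 1], [6, 1, 5, 3,
    1, 2, 1], [1, 3, 2, 1, 5, 4, 1]], [[1, 3, 4, 1, 5, 2, 1], [6, 1, 2, 2, 1, 4, 1], [2, 1, 5,
    3, 1, 2, 1], [2, 1, 5, 3, 1, 2, 1], [2, 1, 4, 3, 1, 2, 1], [2, 1, 5, 3, 1, 2, 1], [2, 1, 4,
    3, 1, 2, 1]]]"

lemma colours_7_safe: "table_safe succs_7 [[1, 3], [0, 2], [0], [1]] [[1], [0], [], []] colours_7 7 6 [0, 1, 2, 3]"
  by code_simp

definition colours_9 :: "nat list list list" where
  "colours_9 =
    [[[5, 1, 1, 2, 4, 1, 2, 1, 3], [1, 2, 3, 1, 3, 1, 4, 2, 1], [1, 2, 3, 1, 3, 1, 4, 2, 1],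
    [5, 2, 1, 1, 3, 1, 4, 1, 3], [4, 1, 1, 3, 1, 5, 2, 1, 3], [1, 5, 2, 3, 1, 2, 1, 3, 1], [4,
    1, 1, 3, 1, 2, 1, 3, 2], [1, 3, 2, 1, 2, 1, 3, 5, 1], [1, 2, 4, 1, 5, 1, 3, 1, 2]], [[1, 2,
    3, 1, 3, 4, 1, 2, 1], [4, 1, 1, 5, 3, 1, 2, 1, 3], [4, 1, 1, 2, 1, 3, 5, 1, 2], [1, 3, 2,
    1, 2, 4, 1, 3, 1], [1, 4, 2, 1, 2, 1, 3, 5, 1], [5, 2, 1, 1, 4, 1, 2, 1, 3], [1, 2, 3, 1,
    5, 1, 4, 2, 1], [4, 1, 1, 3, 2, 1, 5, 1, 3], [1, 3, 2, 1, 2, 1, 5, 3, 1]], [[5, 1, 1, 3, 1,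
    4, 2, 1, 3], [4, 1, 2, 2, 1, 5, 1, 3, 1], [1, 2, 3, 1, 3, 1, 5, 2, 1], [2, 1, 3, 4, 1, 3,
    1, 2, 1], [1, 2, 5, 1, 4, 3, 1, 2, 1], [1, 2, 3, 1, 3, 1, 4, 2, 1], [1, 2, 4, 1, 3, 1, 5,
    2, 1], [3, 1, 1, 2, 1, 3, 1, 2, 5], [1, 2, 4, 1, 5, 3, 1, 2, 1]], [[1, 2, 5, 1, 4, 3, 1, 2,
    1], [1, 2, 3, 1, 3, 4, 1, 2, 1], [4, 1, 1, 2, 3, 1, 2, 1, 3], [5, 1, 1, 2, 1, 4, 1, 2, 3],
    [1, 2, 3, 1, 3, 1, 4, 2, 1], [4, 2, 1, 1, 3, 1, 5, 1, 3], [5, 1, 1, 2, 3, 1, 2, 1, 3], [1,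
    2, 4, 1, 5, 3, 1, 2, 1], [1, 2, 3, 1, 5, 4, 1, 2, 1]]]"

lemma colours_9_safe: "table_safe succs_9 [[1, 3], [0, 2], [0], [1]] [[1], [0], [], []] colours_9 8 5 [0, 1, 2, 3]"
  by code_simp

definition colours_11 :: "nat list list list" where
  "colours_11 =
    [[[4, 1, 1, 2, 1, 3, 1, 2, 5, 1, 3], [1, 2, 3, 1, 3, 1, 2, 5, 1, 2, 1], [1, 2, 3, 1, 3, 1,
    2, 4, 1, 2, 1], [1, 3, 4, 1, 2, 1, 3, 5, 1, 2, 1], [1, 5, 2, 1, 2, 1, 3, 2, 1, 4, 1], [4,
    1, 2, 2, 1, 3, 1, 4, 1, 3, 1], [1, 2, 3, 1, 3, 1, 2, 1, 5, 2, 1], [4, 1, 1, 2, 1, 3, 1, 2,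
    5, 1, 3], [1, 2, 3, 1, 3, 1, 2, 1, 5, 1, 2], [1, 2, 5, 1, 3, 1, 2, 1, 4, 3, 1], [4, 1, 1,
    2, 1, 3, 1, 4, 1, 2, 3]], [[1, 2, 3, 1, 3, 1, 2, 1, 4, 2, 1], [5, 1, 1, 2, 1, 3, 1, 2, 1,
    4, 3], [5, 1, 1, 2, 1, 3, 1, 2, 4, 1, 3], [1, 4, 3, 2, 1, 3, 1, 4, 1, 2, 1], [2, 5, 1, 1,
    2, 1, 3, 1, 2, 1, 3], [2, 3, 1, 1, 2, 1, 3, 1, 2, 1, 4], [2, 5, 1, 1, 2, 1, 3, 1, 2, 1, 4],
    [1, 2, 3, 1, 3, 1, 2, 1, 4, 1, 2], [3, 1, 1, 2, 1, 3, 1, 5, 2, 1, 4], [1, 4, 5, 1, 2, 1, 3,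
    4, 1, 2, 1], [1, 2, 3, 1, 3, 1, 2, 5, 1, 2, 1]], [[1, 2, 4, 1, 3, 1, 2, 5, 1, 2, 1], [5, 1,
    1, 2, 1, 3, 1, 4, 1, 2, 3], [1, 2, 3, 1, 3, 1, 2, 5, 1, 2, 1], [1, 2, 3, 1, 3, 1, 2, 5, 1,
    2, 1], [4, 1, 1, 2, 1, 3, 1, 4, 1, 2, 5], [1, 2, 3, 1, 3, 1, 2, 4, 1, 5, 2], [5, 1, 4, 2,
    1, 3, 1, 2, 1, 3, 1], [2, 4, 3, 1, 2, 1, 3, 4, 1, 2, 1], [2, 3, 1, 1, 2, 1, 3, 1, 2, 1, 5],
    [2, 5, 1, 3, 1, 2, 1, 3, 1, 2, 4], [4, 1, 1, 2, 1, 3, 1, 2, 1, 3, 2]], [[1, 4, 2, 2, 1, 3,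
    1, 5, 1, 3, 1], [1, 2, 3, 1, 3, 1, 2, 5, 1, 2, 1], [5, 1, 1, 3, 1, 2, 1, 4, 3, 1, 2], [3,
    1, 1, 2, 1, 3, 1, 5, 1, 2, 4], [2, 1, 5, 3, 1, 2, 1, 4, 1, 2, 1], [2, 1, 4, 3, 1, 2, 1, 3,
    1, 2, 1], [1, 2, 5, 1, 3, 1, 2, 1, 3, 2, 1], [4, 1, 1, 2, 1, 3, 1, 5, 1, 2, 3], [1, 2, 3,
    1, 3, 1, 2, 1, 4, 2, 1], [5, 1, 1, 2, 1, 3, 1, 2, 4, 1, 3], [1, 4, 3, 1, 3, 1, 2, 5, 1, 2,
    1]]]"

lemma colours_11_safe: "table_safe succs_11 [[1, 3], [0, 2], [0], [1]] [[1], [0], [], []] colours_11 8 5 [0, 1, 2, 3]"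
  by code_simp

definition colours_13 :: "nat list list list" where
  "colours_13 =
    [[[5, 1, 1, 2, 1, 3, 1, 2, 1, 4, 1, 2, 3], [1, 2, 3, 1, 3, 1, 2, 5, 1, 3, 1, 2, 1], [1, 2,
    3, 1, 3, 1, 2, 1, 5, 4, 1, 2, 1], [3, 1, 1, 2, 1, 3, 1, 2, 4, 1, 2, 1, 5], [1, 3, 4, 1, 2,
    1, 3, 5, 1, 2, 3, 1, 2], [1, 2, 5, 1, 3, 1, 2, 4, 1, 3, 1, 2, 1], [4, 2, 1, 1, 3, 1, 2, 1,
    4, 1, 2, 1, 3], [5, 1, 1, 2, 1, 3, 1, 4, 5, 1, 2, 1, 3], [1, 2, 3, 1, 3, 1, 2, 1, 4, 3, 1,
    2, 1], [5, 1, 4, 2, 1, 3, 1, 2, 1, 3, 1, 2, 1], [1, 4, 3, 1, 2, 1, 3, 1, 2, 4, 1, 2, 1],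
    [1, 3, 2, 1, 2, 1, 3, 4, 1, 2, 1, 5, 1], [5, 1, 1, 2, 1, 3, 1, 2, 1, 3, 4, 1, 2]], [[1, 3,
    2, 1, 2, 1, 3, 4, 1, 2, 1, 3, 1], [4, 1, 1, 2, 1, 3, 1, 5, 2, 1, 3, 1, 2], [4, 1, 1, 3, 1,
    2, 1, 5, 4, 1, 3, 1, 2], [3, 1, 5, 2, 1, 3, 1, 2, 1, 3, 1, 2, 1], [1, 2, 4, 1, 3, 1, 2, 1,
    4, 1, 5, 2, 1], [1, 4, 5, 1, 2, 1, 3, 1, 4, 1, 2, 1, 3], [1, 2, 3, 1, 3, 1, 2, 5, 1, 4, 1,
    2, 1], [1, 2, 5, 1, 3, 1, 2, 5, 1, 2, 1, 3, 1], [1, 3, 4, 1, 2, 1, 3, 5, 1, 2, 1, 3, 1],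
    [5, 1, 2, 2, 1, 3, 1, 2, 1, 3, 1, 4, 1], [1, 2, 3, 1, 3, 1, 2, 4, 1, 3, 1, 2, 1], [1, 2, 4,
    3, 1, 2, 1, 4, 1, 3, 1, 2, 1], [1, 3, 5, 1, 2, 1, 3, 1, 2, 4, 1, 2, 1]], [[5, 2, 1, 1, 3,
    1, 2, 1, 3, 1, 2, 1, 3], [4, 2, 1, 1, 3, 1, 2, 1, 3, 1, 2, 1, 3], [1, 2, 3, 1, 3, 1, 2, 4,
    1, 3, 1, 2, 1], [5, 1, 1, 2, 1, 3, 1, 2, 4, 1, 2, 1, 3], [1, 2, 3, 1, 3, 1, 2, 1, 5, 3, 1,
    2, 1], [5, 1, 4, 2, 1, 3, 1, 2, 1, 3, 1, 2, 1], [1, 2, 3, 1, 3, 1, 2, 1, 5, 3, 1, 2, 1],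
    [5, 1, 4, 2, 1, 3, 1, 2, 1, 3, 1, 2, 1], [1, 2, 3, 1, 3, 1, 2, 1, 5, 3, 1, 2, 1], [4, 1, 1,
    3, 1, 2, 1, 5, 4, 1, 2, 1, 3], [5, 1, 2, 3, 1, 2, 1, 4, 1, 2, 1, 3, 1], [1, 4, 2, 2, 1, 3,
    1, 2, 4, 1, 2, 3, 1], [5, 1, 1, 2, 1, 3, 1, 4, 2, 1, 3, 1, 2]], [[1, 5, 2, 3, 1, 2, 1, 3,
    1, 2, 1, 3, 1], [1, 3, 2, 1, 2, 1, 3, 1, 4, 1, 2, 3, 1], [4, 1, 1, 3, 1, 2, 1, 5, 1, 4, 1,
    2, 3], [1, 5, 2, 1, 3, 1, 2, 1, 5, 3, 1, 4, 1], [4, 1, 2, 2, 1, 3, 1, 2, 1, 4, 1, 3, 1],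
    [1, 2, 3, 1, 3, 1, 2, 1, 5, 3, 1, 2, 1], [1, 3, 4, 1, 2, 1, 3, 2, 1, 5, 1, 2, 1], [1, 2, 5,
    1, 3, 1, 2, 1, 4, 3, 1, 2, 1], [4, 1, 1, 2, 1, 3, 1, 2, 4, 1, 5, 1, 3], [1, 2, 3, 1, 3, 1,
    2, 1, 4, 3, 1, 2, 1], [1, 5, 4, 3, 1, 2, 1, 4, 1, 3, 1, 2, 1], [1, 4, 2, 1, 2, 1, 3, 2, 1,
    4, 1, 3, 1], [1, 5, 3, 2, 1, 3, 1, 2, 1, 3, 1, 2, 1]]]"

lemma colours_13_safe: "table_safe succs_13 [[1, 3], [0, 2], [0], [1]] [[1], [0], [], []] colours_13 8 5 [0, 1, 2, 3]"
  by code_simp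

section \<open>Colourability for every cycle length\<close>

definition colorable :: "nat \<Rightarrow> nat \<Rightarrow> nat \<Rightarrow> bool" where
  "colorable n k c \<longleftrightarrow> (\<exists>f. packing_coloring (sierp_verts k n) (sierp_adj (cycle_adj k)) c f)"

lemma position_classes_small:
  "position_classes 4 [0, 1, 3, 2] succs_4"
  "position_classes 5 [0, 1, 3, 4, 2] succs_5"
  "position_classes 6 [0, 1, 3, 4, 5, 2] succs_6"
  "position_classes 7 [0, 1, 3, 4, 5, 6, 2] succs_7"
  "position_classes 9 [0, 1, 3, 4, 5, 6, 7, 8, 2] succs_9"
proof -
  note defs = succs_4_def succs_5_def succs_6_def succs_7_def succs_9_def
  show "position_classes 4 [0, 1, 3, 2] succs_4"
    by (rule position_classesI[OF _ refl]) (simp_all add: defs)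
  show "position_classes 5 [0, 1, 3, 4, 2] succs_5"
    by (rule position_classesI[OF _ refl]) (simp_all add: defs)
  show "position_classes 6 [0, 1, 3, 4, 5, 2] succs_6"
    by (rule position_classesI[OF _ refl]) (simp_all add: defs)
  show "position_classes 7 [0, 1, 3, 4, 5, 6, 2] succs_7"
    by (rule position_classesI[OF _ refl]) (simp_all add: defs)
  show "position_classes 9 [0, 1, 3, 4, 5, 6, 7, 8, 2] succs_9"
    by (rule position_classesI[OF _ refl]) (simp_all add: defs)
qed

text \<open>The smallest length in each residue class modulo 4 is six plus the length of the tail
  after the loop. Residue 1 starts at 13, which leaves 9 to a table of its own.\<close>

lemma position_classes_large:
  assumes "k \<ge> 8"
  shows "k mod 4 = 0 \<Longrightarrow> \<exists>W. position_classes k W succs_8"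
    and "k mod 4 = 2 \<Longrightarrow> \<exists>W. position_classes k W succs_10"
    and "k mod 4 = 3 \<Longrightarrow> \<exists>W. position_classes k W succs_11"
    and "k mod 4 = 1 \<Longrightarrow> k \<noteq> 9 \<Longrightarrow> \<exists>W. position_classes k W succs_13"
proof -
  show "\<exists>W. position_classes k W succs_8" if "k mod 4 = 0"
  proof -
    have "k = 8 + 4 * ((k - 8) div 4)" using assms that by presburger
    then show ?thesis
      using position_classes_loop[of succs_8 "[7, 2]" "(k - 8) div 4"]
      by (auto simp: succs_8_def)
  qed
  show "\<exists>W. position_classes k W succs_10" if "k mod 4 = 2"
  proof -
    have "k = 10 + 4 * ((k - 10) div 4)" using assms that by presburger
    then show ?thesis
      using position_classes_loop[of succs_10 "[7, 8, 9, 2]" "(k - 10) div 4"]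
      by (auto simp: succs_10_def)
  qed
  show "\<exists>W. position_classes k W succs_11" if "k mod 4 = 3"
  proof -
    have "k = 11 + 4 * ((k - 11) div 4)" using assms that by presburger
    then show ?thesis
      using position_classes_loop[of succs_11 "[7, 8, 9, 10, 2]" "(k - 11) div 4"]
      by (auto simp: succs_11_def)
  qed
  show "\<exists>W. position_classes k W succs_13" if "k mod 4 = 1" "k \<noteq> 9"
  proof -
    have "k = 13 + 4 * ((k - 13) div 4)" using assms that by presburger
    then show ?thesis
      using position_classes_loop[of succs_13 "[7, 8, 9, 10, 11, 12, 2]" "(k - 13) div 4"]
      by (auto simp: succs_13_def)
  qed
qed

text \<open>Cycles of length at most 7 are checked with \<open>K = k\<close>. For longer ones
  \<open>K = 8\<close> exceeds the number of colours, so a single check serves a whole family of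
  lengths.\<close>

lemma colorable_of_table:
  assumes "ring_typing k n W R e1 e0 tys \<tau>" "table_safe R e1 e0 tab K c tys" "K = k \<or> c < K"
  shows "colorable n k c"
  using ring_typing.table_safe_imp_packing_coloring[OF assms] unfolding colorable_def by blast

lemma colorable_two_even:
  assumes "even k" "k \<ge> 4" "k \<noteq> 6"
  shows "colorable 2 k 4"
proof -
  have "k = 4 \<or> k \<ge> 8 \<and> k mod 4 = 0 \<or> k \<ge> 8 \<and> k mod 4 = 2" using assms by presburger
  then consider "k = 4" | "k \<ge> 8" "k mod 4 = 0" | "k \<ge> 8" "k mod 4 = 2" by metis
  then show ?thesis
  proof cases
    case 1
    then show ?thesis
      using colorable_of_table[OF ring_typing_two[OF position_classes_small(1)] colours_two_4_safe]
      by simp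
  next
    case 2
    obtain W where "position_classes k W succs_8" using position_classes_large(1)[OF 2] ..
    then show ?thesis using colorable_of_table[OF ring_typing_two colours_two_8_safe] by simp
  next
    case 3
    obtain W where "position_classes k W succs_10" using position_classes_large(2)[OF 3] ..
    then show ?thesis using colorable_of_table[OF ring_typing_two colours_two_10_safe] by simp
  qed
qed

lemma colorable_two_6: "colorable 2 6 5"
  by (rule colorable_of_table[OF ring_typing_two[OF position_classes_small(3)] colours_two_6_safe]) simp

lemma colorable_two_7: "colorable 2 7 5"
  by (rule colorable_of_table[OF ring_typing_two[OF position_classes_small(4)] colours_two_7_safe]) simp

lemma colorable_5: "n \<ge> 2 \<Longrightarrow> colorable n 5 6"
  by (rule colorable_of_table[OF ring_typing_5[OF position_classes_small(2)] colours_5_safe]) simp_all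

lemma colorable_6: "n \<ge> 2 \<Longrightarrow> colorable n 6 6"
  by (rule colorable_of_table[OF ring_typing_even[OF position_classes_small(3)] colours_6_safe]) simp_all

lemma colorable_7: "n \<ge> 2 \<Longrightarrow> colorable n 7 6"
  by (rule colorable_of_table[OF ring_typing_odd[OF position_classes_small(4)] colours_7_safe]) simp_all

lemma colorable_even:
  assumes "even k" "k \<ge> 4" "k \<noteq> 6" "n \<ge> 2"
  shows "colorable n k 5"
proof -
  have "k = 4 \<or> k \<ge> 8 \<and> k mod 4 = 0 \<or> k \<ge> 8 \<and> k mod 4 = 2" using assms by presburger
  then consider "k = 4" | "k \<ge> 8" "k mod 4 = 0" | "k \<ge> 8" "k mod 4 = 2" by metis
  then show ?thesis
  proof cases
    case 1
    then show ?thesis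
      using colorable_of_table[OF ring_typing_even[OF position_classes_small(1)] colours_4_safe] assms
      by simp
  next
    case 2
    obtain W where "position_classes k W succs_8" using position_classes_large(1)[OF 2] ..
    then show ?thesis using colorable_of_table[OF ring_typing_even colours_8_safe] assms by simp
  next
    case 3
    obtain W where "position_classes k W succs_10" using position_classes_large(2)[OF 3] ..
    then show ?thesis using colorable_of_table[OF ring_typing_even colours_10_safe] assms by simp
  qed
qed

lemma colorable_odd:
  assumes "odd k" "k \<ge> 9" "n \<ge> 2"
  shows "colorable n k 5"
proof -
  have "k \<ge> 8 \<and> (k mod 4 = 1 \<or> k mod 4 = 3)" using assms by presburger
  then consider "k = 9" | "k \<ge> 8" "k mod 4 = 1" "k \<noteq> 9" | "k \<ge> 8" "k mod 4 = 3" by metis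
  then show ?thesis
  proof cases
    case 1
    then show ?thesis
      using colorable_of_table[OF ring_typing_odd[OF position_classes_small(5)] colours_9_safe] assms
      by simp
  next
    case 2
    obtain W where "position_classes k W succs_13" using position_classes_large(4)[OF 2] ..
    then show ?thesis using colorable_of_table[OF ring_typing_odd colours_13_safe] assms by simp
  next
    case 3
    obtain W where "position_classes k W succs_11" using position_classes_large(3)[OF 3] ..
    then show ?thesis using colorable_of_table[OF ring_typing_odd colours_11_safe] assms by simp
  qed
qed

subsection \<open>Lower bounds\<close>

fun word_adj :: "nat \<Rightarrow> nat list \<Rightarrow> nat list \<Rightarrow> bool" where
  "word_adj K (x # u) (y # v) \<longleftrightarrow>
     (if x = y then word_adj K u v
      else (y = Suc x \<or> x = Suc y \<or> (x = 0 \<and> Suc y = K) \<or> (y = 0 \<and> Suc x = K)) \<and>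
        list_all (\<lambda>z. z = y) u \<and> list_all (\<lambda>z. z = x) v)"
| "word_adj K u v \<longleftrightarrow> False"

lemma word_adj_sound:
  assumes "word_adj K u v" "length u = length v" "set u \<subseteq> {..<k}" "set v \<subseteq> {..<k}" "K = 0 \<or> K = k"
  shows "sierp_adj (cycle_adj k) u v"
  using assms
proof (induction K u v rule: word_adj.induct)
  case (1 K x u y v)
  show ?case
  proof (cases "x = y")
    case True
    then have "sierp_adj (cycle_adj k) u v" using 1 by auto
    then obtain w a b m where "a \<noteq> b" "cycle_adj k a b" "u = w @ a # replicate m b"
        "v = w @ b # replicate m a"
      unfolding sierp_adj_iff by blast
    then show ?thesis unfolding sierp_adj_iff True by (intro exI[of _ "y # w"]) auto
  next
    case False
    have "u = replicate (length u) y" "v = replicate (length u) x"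
      using 1 False by (auto simp: list_all_iff intro!: replicate_eqI)
    moreover have "cycle_adj k x y" using 1 False by (auto simp: cycle_adj_def)
    ultimately show ?thesis
      unfolding sierp_adj_iff using False by (metis append_Nil)
  qed
qed auto

definition adj_table :: "nat \<Rightarrow> nat list list \<Rightarrow> nat list list" where
  "adj_table K ws = map (\<lambda>u. filter (\<lambda>j. word_adj K u (ws ! j)) [0..<length ws]) ws"

text \<open>The words in \<open>ws\<close> span a subgraph of the Sierpinski graph over any cycle with at least \<open>B\<close>
  vertices; \<open>K = 0\<close> means that the edge closing the cycle is not used, otherwise \<open>K\<close> is the length
  of the cycle.\<close>

definition refuted :: "nat \<Rightarrow> nat \<Rightarrow> nat \<Rightarrow> nat \<Rightarrow> nat list list \<Rightarrow> bool list list \<Rightarrow> branching \<Rightarrow> bool"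
where
  "refuted K B n c ws ds t \<longleftrightarrow> distinct ws \<and>
     list_all (\<lambda>u. length u = n \<and> list_all (\<lambda>x. x < B) u) ws \<and>
     in_range (length ws) t \<and> refutes (conflicts (adj_table K ws) c) t ds"

lemma refuted_verts:
  assumes "refuted K B n c ws ds t" "B \<le> k" "i < length ws"
  shows "ws ! i \<in> sierp_verts k n"
  using assms nth_mem[OF assms(3)] unfolding refuted_def sierp_verts_def list_all_iff by fastforce

lemma refuted_adj_on:
  assumes "refuted K B n c ws ds t" "K = 0 \<or> K = k" "B \<le> k"
    and "i < length (adj_table K ws)" "j \<in> set (adj_table K ws ! i)"
  shows "j < length (adj_table K ws) \<and>
    adj_on (sierp_verts k n) (sierp_adj (cycle_adj k)) (ws ! i) (ws ! j)"
proof -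
  have ij: "i < length ws" "j < length ws" "word_adj K (ws ! i) (ws ! j)"
    using assms(4,5) by (auto simp: adj_table_def)
  then show ?thesis
    using word_adj_sound[OF ij(3) _ _ _ assms(2)] refuted_verts[OF assms(1,3)]
    by (auto simp: adj_on_def sierp_verts_def adj_table_def)
qed

lemma refuted_sound:
  assumes r: "refuted K B n c ws ds t" and k: "K = 0 \<or> K = k" "B \<le> k"
    and f: "packing_coloring (sierp_verts k n) (sierp_adj (cycle_adj k)) c f"
  shows "\<not> admits (length ws) (\<lambda>i. f (ws ! i) - 1) ds"
proof -
  have len: "length (adj_table K ws) = length ws" by (simp add: adj_table_def)
  have "inj_on ((!) ws) {..<length ws}"
    using r unfolding refuted_def by (auto intro: inj_on_nth)
  then show ?thesis
    using refutes_sound[where \<phi> = "(!) ws" and V = "sierp_verts k n" and adj = "adj_table K ws",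
        OF refuted_adj_on[OF r k] _ _ f] r refuted_verts[OF r k(2)] unfolding refuted_def len by auto
qed

lemma refuted_range:
  assumes "refuted K B n c ws ds t" "B \<le> k" "i < length ws"
    and "packing_coloring (sierp_verts k n) E c' f"
  shows "1 \<le> f (ws ! i) \<and> f (ws ! i) \<le> c'"
  using refuted_verts[OF assms(1-3)] assms(4) unfolding packing_coloring_iff by auto

lemma refuted_imp_not_colorable:
  assumes r: "refuted K B n c ws (replicate N (replicate c True)) t" "N = length ws"
    and k: "K = 0 \<or> K = k" "B \<le> k"
  shows "\<not> colorable n k c"
proof
  assume "colorable n k c"
  then obtain f where f: "packing_coloring (sierp_verts k n) (sierp_adj (cycle_adj k)) c f"
    unfolding colorable_def by blast
  have "admits N (\<lambda>i. f (ws ! i) - 1) (replicate N (replicate c True))"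
    unfolding admits_def
  proof (intro conjI allI impI)
    fix i assume i: "i < N"
    then have "f (ws ! i) - 1 < c"
      using refuted_range[OF r(1) k(2) _ f, of i] r(2) by auto
    then show "f (ws ! i) - 1 < length (replicate N (replicate c True) ! i)"
      and "replicate N (replicate c True) ! i ! (f (ws ! i) - 1)" using i by simp_all
  qed simp
  then show False using refuted_sound[OF r(1) k f] r(2) by simp
qed

section \<open>Embedded copies, rotations and odd cycles\<close>

text \<open>The words with a fixed prefix of zeros form a copy of the smaller graph; thus lower
  bounds for \<open>n = 2\<close> and \<open>n = 3\<close> persist for all larger
  \<open>n\<close>.\<close>

lemma colorable_prefix:
  assumes "colorable n k c" "m \<le> n" "k > 0"
  shows "colorable m k c"
proof -
  obtain f where f: "packing_coloring (sierp_verts k n) (sierp_adj (cycle_adj k)) c f"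
    using assms(1) unfolding colorable_def by blast
  let ?p = "replicate (n - m) 0 :: nat list"
  have "packing_coloring (sierp_verts k m) (sierp_adj (cycle_adj k)) c (\<lambda>u. f (?p @ u))"
  proof (rule packing_coloring_pullback[OF f])
    fix u v assume "sierp_adj (cycle_adj k) u v"
    then obtain w a b m where "a \<noteq> b" "cycle_adj k a b" "u = w @ a # replicate m b"
        "v = w @ b # replicate m a"
      unfolding sierp_adj_iff by blast
    then show "sierp_adj (cycle_adj k) (?p @ u) (?p @ v)"
      unfolding sierp_adj_iff by (intro exI[of _ "?p @ w"]) auto
  qed (use assms in \<open>auto simp: sierp_verts_def inj_on_def\<close>)
  then show ?thesis unfolding colorable_def by blast
qed

lemma rotate_adj:
  assumes "cycle_adj k a b"
  shows "cycle_adj k ((a + r) mod k) ((b + r) mod k)"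
  using assms unfolding cycle_adj_def by (auto simp: mod_simps)

text \<open>Adding \<open>r\<close> to every letter preserves edges and is injective. It carries a
  statement about one fixed window to every place around the cycle.\<close>

lemma packing_coloring_rotate:
  assumes "packing_coloring (sierp_verts k n) (sierp_adj (cycle_adj k)) c f"
  shows "packing_coloring (sierp_verts k n) (sierp_adj (cycle_adj k)) c
           (\<lambda>u. f (map (\<lambda>x. (x + r) mod k) u))"
proof (rule packing_coloring_pullback[OF assms])
  let ?\<rho> = "\<lambda>x. (x + r) mod k"
  have inj: "inj_on ?\<rho> {..<k}"
  proof (rule linorder_inj_onI')
    fix x y assume xy: "x \<in> {..<k}" "y \<in> {..<k}" "x < y"
    then have "\<not> k dvd (y + r) - (x + r)" using nat_dvd_not_less[of "y - x" k] by auto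
    then show "?\<rho> x \<noteq> ?\<rho> y" using mod_eq_dvd_iff_nat[of "x + r" "y + r" k] xy(3) by auto
  qed
  show "inj_on (map ?\<rho>) (sierp_verts k n)"
    by (intro inj_on_mapI inj_on_subset[OF inj]) (auto simp: sierp_verts_def)
  show "map ?\<rho> u \<in> sierp_verts k n" if "u \<in> sierp_verts k n" for u
    using that by (cases "k = 0") (auto simp: sierp_verts_def)
  show "sierp_adj (cycle_adj k) (map ?\<rho> u) (map ?\<rho> v)"
    if "u \<in> sierp_verts k n" "v \<in> sierp_verts k n" and uv: "sierp_adj (cycle_adj k) u v" for u v
  proof -
    obtain w a b m where *: "a \<noteq> b" "cycle_adj k a b" "u = w @ a # replicate m b"
        "v = w @ b # replicate m a"
      using uv unfolding sierp_adj_iff by blast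
    have "?\<rho> a \<noteq> ?\<rho> b" using inj * unfolding cycle_adj_def by (auto dest: inj_onD)
    then show ?thesis
      unfolding sierp_adj_iff using * rotate_adj[of k a b r]
      by (intro exI[of _ "map ?\<rho> w"] exI[of _ "?\<rho> a"] exI[of _ "?\<rho> b"] exI[of _ m])
        (simp add: map_replicate)
  qed
qed

lemma no_alternation_on_odd_cycle:
  assumes "odd k" "\<And>r. P (Suc r mod k) \<longleftrightarrow> \<not> P (r mod k)"
  shows False
proof -
  have "P (r mod k) \<longleftrightarrow> (P 0 \<longleftrightarrow> even r)" for r
  proof (induction r)
    case (Suc r)
    then show ?case using assms(2)[of r] by simp
  qed simp
  from this[of k] show False using assms(1) by simp
qed

section \<open>Windows and their refutation trees\<close>

definition words_three :: "nat list list" where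
  "words_three =
    [[1, 2], [1, 3], [2, 0], [2, 1], [2, 2], [2, 3], [3, 0], [3, 1], [3, 2], [3, 3]]"

lemma refuted_three: "refuted 0 4 2 3 words_three (replicate 10 (replicate 3 True))
  (Br 3 [Br 4 [Br 0 [Br 2 []], Br 0 [Br 2 []]], Br 4 [Br 5 [Br 0 [Br 1 [Br 2 [Br 8 [Br 7 [Br
     9 []], Br 6 [Br 7 []]]]]]], Br 0 [Br 1 []]], Br 5 [Br 4 [Br 8 []], Br 4 [Br 8 [Br 7 [Br 9
     []]]]]])"
  by code_simp

definition words_two_6 :: "nat list list" where
  "words_two_6 =
    [[2, 2], [2, 3], [2, 4], [3, 0], [3, 1], [3, 2], [3, 3], [3, 4], [3, 5], [4, 0], [4, 1],
    [4, 2], [4, 3], [4, 4], [4, 5], [5, 3], [5, 4], [5, 5]]"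

lemma refuted_two_6: "refuted 6 6 2 4 words_two_6 (replicate 18 (replicate 4 True))
  (Br 7 [Br 12 [Br 6 [Br 8 [Br 11 [Br 10 [Br 13 [Br 14 []]]]], Br 8 [Br 11 [Br 10 [Br 13 [Br
     14 []]]]]], Br 14 [Br 13 [Br 9 [Br 16 []], Br 6 [Br 8 []]], Br 10 [Br 9 [Br 11 [Br 13 [Br
     16 [Br 15 [Br 17 []]]]]], Br 6 [Br 8 []]], Br 6 [Br 8 []]], Br 6 [Br 8 [Br 4 [Br 5 []]],
     Br 8 [Br 3 [Br 4 []]]]], Br 12 [Br 13 [Br 11 [Br 6 [Br 5 [Br 3 [Br 8 []]]]], Br 11 [Br 6
     [Br 5 [Br 3 [Br 8 []]]]]], Br 5 [Br 6 [Br 3 [Br 8 []]], Br 3 [Br 8 []]], Br 5 [Br 6 [Br 1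
     [Br 4 []]], Br 3 [Br 8 []]]], Br 5 [Br 6 [Br 1 [Br 4 []], Br 1 [Br 4 []]], Br 3 [Br 4 [Br
     1 [Br 0 [Br 2 []]]], Br 1 [Br 0 [Br 2 []]]], Br 12 [Br 11 [Br 13 []], Br 6 [Br 8 [Br 3 [Br
     4 [Br 11 [Br 10 [Br 13 [Br 14 []]]]]]]]]], Br 14 [Br 13 [Br 9 [Br 16 []], Br 9 [Br 16
     []]], Br 12 [Br 13 [Br 9 [Br 10 []]], Br 9 [Br 10 []]], Br 11 [Br 10 [Br 12 []], Br 9 [Br
     10 []]]]])"
  by code_simp

definition words_two_7 :: "nat list list" where
  "words_two_7 =
    [[3, 3], [3, 4], [3, 5], [4, 0], [4, 1], [4, 2], [4, 3], [4, 4], [4, 5], [4, 6], [5, 3],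
    [5, 4], [5, 5]]"

lemma refuted_two_7: "refuted 7 7 2 4 words_two_7 (replicate 13 (replicate 4 True))
  (Br 8 [Br 7 [Br 9 [Br 11 [Br 5 [Br 6 []]], Br 11 [Br 6 [Br 1 [Br 5 []]]]], Br 9 [Br 11 [Br
     3 [Br 4 []]], Br 11 [Br 10 [Br 12 [Br 5 [Br 4 [Br 6 []], Br 1 [Br 6 []]]]]]], Br 9 [Br 11
     [Br 3 [Br 4 [Br 6 [Br 1 [Br 5 []], Br 1 [Br 0 [Br 2 []]]]]]], Br 11 [Br 10 [Br 12 [Br 5
     [Br 4 [Br 6 []], Br 3 [Br 4 []]]]]]]], Br 11 [Br 10 [Br 12 [Br 7 [Br 6 [Br 3 [Br 9 []]]]],
     Br 12 [Br 7 [Br 6 [Br 3 [Br 9 []]]]]], Br 6 [Br 7 [Br 3 [Br 9 []]], Br 3 [Br 9 []]], Br 6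
     [Br 7 [Br 1 [Br 5 []]], Br 3 [Br 9 []]]], Br 5 [Br 6 [Br 4 [Br 1 [Br 0 [Br 2 []]]], Br 4
     [Br 3 [Br 9 []]]], Br 6 [Br 1 [Br 7 []], Br 1 [Br 3 [Br 4 []]]], Br 6 [Br 1 [Br 7 []], Br
     1 [Br 0 [Br 2 []]]]], Br 6 [Br 7 [Br 1 [Br 5 []], Br 1 [Br 5 []]], Br 1 [Br 0 [Br 2 []],
     Br 0 [Br 2 [Br 4 [Br 5 []]]]], Br 3 [Br 4 [Br 9 []], Br 4 [Br 5 []]]]])"
  by code_simp

text \<open>The middle vertices of blocks 3 and 4 come first, so that their allowed colours can be
  prescribed apart from the rest: once only colour 1, once everything else.\<close>

definition words_parity :: "nat list list" where
  "words_parity =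
    [[3, 3], [4, 4], [2, 1], [2, 2], [2, 3], [2, 4], [2, 5], [3, 0], [3, 1], [3, 2], [3, 4],
    [3, 5], [3, 6], [4, 1], [4, 2], [4, 3], [4, 5], [4, 6], [4, 7], [5, 2], [5, 3], [5, 4], [5,
    5], [5, 6]]"

lemma refuted_both: "refuted 0 8 2 4 words_parity (replicate 2 (True # replicate 3 False) @ replicate 22 (replicate 4 True))
  (Br 0 [Br 1 [Br 9 [Br 10 [Br 15 [Br 16 [Br 11 [Br 13 [Br 14 []]]], Br 4 [Br 8 [Br 16 [Br 21
     [Br 20 [Br 22 []], Br 17 [Br 18 []]]]]]], Br 4 [Br 3 [Br 5 []], Br 3 [Br 5 [Br 7 [Br 8
     []]]]]], Br 4 [Br 10 [Br 15 [Br 11 [Br 12 [Br 16 [Br 21 [Br 20 [Br 22 []], Br 17 [Br 18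
     []]], Br 14 [Br 21 [Br 20 [Br 22 []], Br 17 [Br 18 [Br 20 [Br 19 [Br 22 [Br 23
     []]]]]]]]]]]], Br 3 [Br 5 []]], Br 5 [Br 6 [Br 2 [Br 3 []]], Br 2 [Br 3 []]], Br 10 [Br 15
     []]], Br 10 [Br 15 [Br 11 [Br 12 []]], Br 15 [Br 11 [Br 12 [Br 14 [Br 13 [Br 16
     []]]]]]]]]])"
  by code_simp

lemma refuted_none: "refuted 0 8 2 4 words_parity (replicate 2 (False # replicate 3 True) @ replicate 22 (replicate 4 True))
  (Br 1 [Br 16 [Br 21 [Br 17 [Br 15 [Br 10 [Br 14 []]]], Br 17 [Br 15 [Br 10 [Br 14 []]]]],
     Br 15 [Br 10 [Br 14 []], Br 10 [Br 14 [Br 17 [Br 18 [Br 21 [Br 20 [Br 22 []]]]]]]], Br 15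
     [Br 10 [Br 14 []], Br 0 [Br 10 [Br 11 []]]]], Br 0 [Br 10 [Br 11 [Br 15 []], Br 11 [Br 15
     [Br 14 [Br 13 [Br 9 [Br 4 [Br 8 []], Br 4 [Br 3 [Br 5 []]]]]]]]], Br 15 [Br 10 [Br 14 []],
     Br 10 [Br 11 []]]], Br 0 [Br 10 [Br 11 [Br 15 []], Br 9 [Br 4 [Br 8 []]]], Br 15 [Br 10
     [Br 14 []], Br 10 [Br 11 []]]]])"
  by code_simp

definition words_pair :: "nat list list" where
  "words_pair =
    [[0, 0], [0, 1], [0, 2], [0, 3], [0, 4], [1, 0], [1, 1], [1, 2], [1, 3], [1, 4]]"

lemma refuted_pair: "refuted 5 5 2 5 words_pair (replicate 10 (replicate 4 True @ [False]))
  (Br 1 [Br 5 [Br 0 [Br 2 [Br 6 [Br 7 [Br 8 [Br 9 []]]]], Br 2 [Br 6 [Br 7 [Br 8 [Br 9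
     []]]]]], Br 0 [Br 2 [Br 3 [Br 4 []]], Br 2 [Br 3 [Br 4 []]]], Br 0 [Br 2 [Br 3 [Br 4 []]],
     Br 2 [Br 3 [Br 4 []]]]], Br 5 [Br 6 [Br 9 [Br 0 [Br 2 [Br 3 [Br 4 []]]]], Br 9 [Br 0 [Br 2
     [Br 3 [Br 4 []]]]]], Br 3 [Br 2 [Br 4 []], Br 0 [Br 4 []]], Br 3 [Br 2 [Br 4 []], Br 0 [Br
     4 []]]], Br 8 [Br 9 [Br 7 [Br 5 [Br 6 []]], Br 7 [Br 5 [Br 6 []]]], Br 5 [Br 6 [Br 9 []],
     Br 6 [Br 7 []]], Br 6 [Br 5 [Br 7 []], Br 5 [Br 9 []]]], Br 8 [Br 9 [Br 7 [Br 5 [Br 6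
     []]], Br 7 [Br 5 [Br 6 []]]], Br 5 [Br 6 [Br 9 []], Br 6 [Br 7 []]], Br 5 [Br 6 [Br 9 []],
     Br 6 [Br 7 []]]]])"
  by code_simp

definition words_three_4 :: "nat list list" where
  "words_three_4 =
    [[1, 1, 2], [1, 2, 1], [1, 2, 2], [1, 2, 3], [1, 3, 2], [2, 1, 0], [2, 1, 1], [2, 1, 2],
    [2, 1, 3], [2, 2, 0], [2, 2, 1], [2, 2, 2], [2, 2, 3], [2, 3, 0], [2, 3, 1], [2, 3, 2], [2,
    3, 3], [3, 1, 1], [3, 1, 2], [3, 1, 3], [3, 2, 0], [3, 2, 1], [3, 2, 2], [3, 2, 3], [3, 3,
    1], [3, 3, 2], [3, 3, 3]]"

lemma refuted_three_4: "refuted 4 4 3 4 words_three_4 (replicate 27 (replicate 4 True))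
  (Br 16 [Br 22 [Br 15 [Br 13 [Br 21 [Br 18 [Br 20 []]]], Br 13 [Br 21 [Br 18 [Br 20 []]]]],
     Br 15 [Br 13 [Br 12 [Br 9 [Br 11 []]]], Br 13 [Br 14 [Br 20 [Br 21 [Br 23 []], Br 18 [Br
     21 []]]]]], Br 15 [Br 13 [Br 12 [Br 9 [Br 11 []]]], Br 13 [Br 14 [Br 12 [Br 9 [Br 11 []],
     Br 9 [Br 10 [Br 11 [Br 6 [Br 2 [Br 5 [Br 7 []], Br 5 [Br 7 []]], Br 8 [Br 5 [Br 7 []], Br
     2 [Br 1 [Br 3 []]]], Br 2 [Br 1 [Br 3 []], Br 1 [Br 0 [Br 3 [Br 4 []]]]]]]]]]]]]], Br 22
     [Br 21 [Br 23 [Br 13 [Br 14 [Br 12 [Br 15 []]]]], Br 23 [Br 13 [Br 14 [Br 12 [Br 15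
     []]]]]], Br 14 [Br 13 [Br 15 []], Br 12 [Br 15 []]], Br 14 [Br 13 [Br 15 []], Br 12 [Br 15
     []]]], Br 21 [Br 22 [Br 18 [Br 20 []], Br 18 [Br 20 []]], Br 23 [Br 20 [Br 22 []], Br 18
     [Br 17 [Br 19 []]]], Br 14 [Br 13 [Br 15 []], Br 12 [Br 15 []]]], Br 25 [Br 23 [Br 24 [Br
     26 []], Br 24 [Br 26 []]], Br 23 [Br 20 [Br 22 []], Br 20 [Br 21 [Br 18 [Br 17 [Br 19
     []]]]]], Br 21 [Br 20 [Br 22 []], Br 20 [Br 23 []]]]])"
  by code_simp

text \<open>The window surrounds the link between \<open>1 2 2\<close> and \<open>2 1 1\<close>.
  Such links between rings are missing for \<open>n = 2\<close>, where four colours still suffice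
  for even \<open>k\<close> other than 6.\<close>

definition words_link :: "nat list list" where
  "words_link =
    [[1, 2, 1], [1, 2, 2], [1, 2, 3], [1, 2, 4], [1, 3, 0], [1, 3, 1], [1, 3, 2], [1, 3, 3],
    [1, 3, 4], [2, 0, 0], [2, 0, 1], [2, 0, 2], [2, 1, 0], [2, 1, 1], [2, 1, 2], [2, 1, 3], [2,
    2, 0], [2, 2, 1], [2, 2, 2]]"

lemma refuted_link: "refuted 0 6 3 4 words_link (replicate 19 (replicate 4 True))
  (Br 13 [Br 1 [Br 12 [Br 14 [Br 0 [Br 2 [Br 3 [Br 6 []]]]], Br 14 [Br 0 [Br 2 [Br 3 [Br 6
     []]]]]], Br 14 [Br 12 [Br 15 [Br 17 [Br 16 [Br 18 []]]]], Br 12 [Br 10 [Br 9 [Br 11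
     []]]]], Br 14 [Br 12 [Br 15 [Br 17 [Br 16 [Br 18 []]]]], Br 12 [Br 10 [Br 9 [Br 11
     []]]]]], Br 14 [Br 15 [Br 17 [Br 1 [Br 0 [Br 2 []]]], Br 17 [Br 1 [Br 0 [Br 2 []]]]], Br
     10 [Br 12 [Br 0 [Br 1 []]], Br 0 [Br 1 []]], Br 1 [Br 0 [Br 2 []], Br 0 [Br 2 [Br 3 [Br 6
     []]]]]], Br 2 [Br 1 [Br 3 [Br 6 []], Br 3 [Br 6 []]], Br 1 [Br 0 [Br 3 [Br 6 [Br 5 [Br 7
     []]]]], Br 0 [Br 3 [Br 6 [Br 5 [Br 7 []]]]]], Br 14 [Br 15 [Br 17 []], Br 1 [Br 0 [Br 12
     [Br 10 [Br 15 [Br 17 [Br 16 [Br 18 []]]]]]]]]], Br 2 [Br 1 [Br 3 [Br 6 []], Br 3 [Br 6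
     []]], Br 6 [Br 5 [Br 7 []], Br 0 [Br 1 []]], Br 6 [Br 5 [Br 7 []], Br 1 [Br 0 [Br 3 [Br 5
     [Br 4 [Br 7 [Br 8 []]]]]]]]]])"
  by code_simp

text \<open>The words are ordered by distance from \<open>0 1 1\<close>, an end of the link to
  \<open>1 0 0\<close>; the branching starts there.\<close>

definition words_three_6 :: "nat list list" where
  "words_three_6 =
    [[0, 1, 1], [0, 1, 2], [0, 1, 0], [1, 0, 0], [0, 1, 3], [0, 2, 1], [0, 1, 5], [0, 0, 1],
    [1, 0, 1], [1, 0, 5], [0, 1, 4], [0, 2, 2], [0, 2, 0], [0, 0, 2], [0, 0, 0], [1, 0, 2], [1,
    1, 0], [1, 0, 4], [1, 5, 0], [0, 2, 3], [0, 2, 5], [0, 0, 3], [0, 0, 5], [1, 0, 3], [1, 1,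
    1], [1, 1, 5], [1, 5, 1], [1, 5, 5], [0, 2, 4], [0, 0, 4], [1, 1, 2], [1, 1, 4], [1, 5, 2],
    [1, 5, 4], [1, 1, 3], [1, 5, 3]]"

lemma refuted_three_6: "refuted 6 6 3 5 words_three_6 (replicate 36 (replicate 5 True))
  (Br 0 [Br 3 [Br 9 [Br 17 [Br 18 [Br 8 [Br 15 [Br 1 [Br 2 []]], Br 1 [Br 2 []]], Br 8 [Br 15
     [Br 1 [Br 2 []]], Br 1 [Br 2 []]]], Br 1 [Br 2 [Br 8 [Br 15 [Br 16 []]]], Br 2 [Br 8 [Br
     15 [Br 16 []]]]], Br 1 [Br 2 [Br 8 [Br 15 [Br 16 []]]], Br 2 [Br 8 [Br 15 [Br 16 []]]]]],
     Br 1 [Br 2 [Br 8 [Br 15 []]], Br 2 [Br 8 [Br 15 []]]], Br 1 [Br 2 [Br 8 [Br 15 [Br 16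
     []]]], Br 2 [Br 8 [Br 15 [Br 16 []]]]], Br 1 [Br 2 [Br 8 [Br 15 [Br 16 []]]], Br 2 [Br 8
     [Br 15 [Br 16 []]]]]], Br 9 [Br 17 [Br 18 [Br 15 [Br 23 [Br 1 [Br 2 []]], Br 1 [Br 2 []]],
     Br 15 [Br 23 [Br 8 [Br 16 [Br 24 []]]], Br 1 [Br 2 []]]], Br 15 [Br 8 [Br 23 [Br 1 [Br 2
     []]], Br 1 [Br 2 []]], Br 16 [Br 8 [Br 1 [Br 2 []]], Br 1 [Br 2 []]], Br 1 [Br 2 []]], Br
     16 [Br 8 [Br 24 [Br 25 []], Br 1 [Br 2 []]], Br 15 [Br 8 [Br 1 [Br 2 []]], Br 1 [Br 2
     []]], Br 1 [Br 2 []]]], Br 18 [Br 26 [Br 27 [Br 8 [Br 17 [Br 23 []]]], Br 27 [Br 8 [Br 17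
     [Br 23 []]]]], Br 23 [Br 17 [Br 1 [Br 2 []]], Br 1 [Br 2 []]], Br 23 [Br 17 [Br 1 [Br 2
     []]], Br 8 [Br 15 [Br 16 []]]]], Br 16 [Br 8 [Br 24 [Br 25 []], Br 1 [Br 2 []]], Br 15 [Br
     8 [Br 1 [Br 2 []]], Br 1 [Br 2 []]], Br 1 [Br 2 []]], Br 1 [Br 2 [Br 4 [Br 5 [Br 10 [Br 11
     [Br 12 []]]]]], Br 2 [Br 6 [Br 7 [Br 10 [Br 13 [Br 14 []]]]]]]], Br 1 [Br 2 [Br 10 [Br 4
     [Br 5 [Br 6 [Br 7 [Br 11 [Br 12 []]]]]], Br 4 [Br 5 [Br 11 [Br 12 []]]]], Br 5 [Br 11 [Br
     12 []], Br 4 [Br 10 []]]], Br 2 [Br 10 [Br 6 [Br 4 [Br 5 [Br 7 [Br 11 [Br 12 []]]]]], Br 6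
     [Br 7 [Br 13 [Br 14 []]]]], Br 5 [Br 11 [Br 12 []], Br 4 [Br 10 [Br 6 [Br 11 [Br 12 [Br 19
     [Br 20 []]]]]]]]], Br 2 [Br 7 [Br 13 [Br 14 []], Br 6 [Br 10 []]], Br 7 [Br 13 [Br 14 []],
     Br 6 [Br 10 [Br 4 [Br 13 [Br 14 [Br 21 [Br 22 []]]]]]]]]], Br 1 [Br 2 [Br 10 [Br 4 [Br 5
     [Br 6 [Br 7 [Br 11 [Br 12 []]]]]], Br 4 [Br 5 [Br 11 [Br 12 []]]]], Br 5 [Br 11 [Br 12
     []], Br 4 [Br 10 []]]], Br 2 [Br 10 [Br 6 [Br 4 [Br 5 [Br 7 [Br 13 [Br 14 []]]]]], Br 6
     [Br 7 [Br 13 [Br 14 []]]]], Br 5 [Br 11 [Br 12 []], Br 4 [Br 10 [Br 6 [Br 11 [Br 12 [Br 19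
     [Br 20 []]]]]]]]], Br 2 [Br 7 [Br 13 [Br 14 []], Br 6 [Br 10 []]], Br 7 [Br 13 [Br 14 []],
     Br 6 [Br 10 [Br 4 [Br 13 [Br 14 [Br 21 [Br 22 []]]]]]]]]]], Br 1 [Br 4 [Br 5 [Br 2 [Br 6
     [Br 3 [Br 7 [Br 8 [Br 9 []]]]], Br 3 [Br 6 [Br 8 [Br 9 []]]]], Br 2 [Br 6 [Br 3 [Br 7 [Br
     8 [Br 9 []]]]], Br 3 [Br 6 [Br 8 [Br 9 []]]]]], Br 3 [Br 8 [Br 9 [Br 2 [Br 5 [Br 6 [Br 7
     []]]]], Br 5 [Br 2 [Br 6 [Br 7 []]]]], Br 5 [Br 2 [Br 6 []]], Br 5 [Br 2 [Br 6 [Br 7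
     []]]]], Br 3 [Br 8 [Br 9 [Br 2 [Br 5 [Br 6 [Br 7 []]]]], Br 5 [Br 2 [Br 6 [Br 7 []]]]], Br
     5 [Br 2 [Br 6 []]], Br 5 [Br 2 [Br 6 [Br 7 []]]]]], Br 3 [Br 8 [Br 9 [Br 2 [Br 6 []]], Br
     9 [Br 2 [Br 6 []]]], Br 2 [Br 6 [Br 7 []], Br 4 [Br 5 [Br 6 [Br 7 [Br 8 [Br 9 [Br 10 [Br
     11 [Br 12 []]]]]]]]]], Br 2 [Br 6 [Br 7 []], Br 4 [Br 5 [Br 6 [Br 7 [Br 8 [Br 9 [Br 10 [Br
     11 [Br 12 []]]]]]]]]]], Br 3 [Br 8 [Br 9 [Br 2 [Br 6 [Br 7 []]]], Br 9 [Br 2 [Br 6 [Br 7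
     []]]]], Br 2 [Br 6 [Br 7 []], Br 4 [Br 5 [Br 6 [Br 7 [Br 8 [Br 9 [Br 15 [Br 16 []]]]]]]]],
     Br 2 [Br 6 [Br 7 []], Br 4 [Br 5 [Br 6 [Br 7 [Br 8 [Br 9 [Br 10 [Br 13 [Br 14
     []]]]]]]]]]], Br 3 [Br 8 [Br 9 [Br 2 [Br 6 [Br 7 []]]], Br 9 [Br 2 [Br 6 [Br 7 []]]]], Br
     2 [Br 6 [Br 7 []], Br 4 [Br 5 [Br 6 [Br 7 [Br 8 [Br 9 [Br 15 [Br 16 []]]]]]]]], Br 2 [Br 6
     [Br 7 []], Br 4 [Br 5 [Br 6 [Br 7 [Br 8 [Br 9 [Br 10 [Br 13 [Br 14 []]]]]]]]]]]], Br 2 [Br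
     1 [Br 4 [Br 5 [Br 6 [Br 7 [Br 10 [Br 3 [Br 8 [Br 9 []], Br 8 [Br 9 [Br 15 [Br 16
     []]]]]]]], Br 6 [Br 7 [Br 10 [Br 13 [Br 14 [Br 3 [Br 8 [Br 9 []], Br 8 [Br 9 [Br 15 [Br 16
     []]]]]]]]]]], Br 6 [Br 7 [Br 5 [Br 10 [Br 11 [Br 12 [Br 3 [Br 8 [Br 9 []], Br 8 [Br 9 [Br
     15 [Br 16 []]]]]]]]]], Br 5 [Br 7 [Br 11 [Br 12 [Br 3 [Br 8 [Br 9 []], Br 8 [Br 9 [Br 15
     [Br 16 []]]]]]]]]], Br 3 [Br 8 [Br 9 [Br 5 [Br 6 [Br 7 []]]], Br 5 [Br 6 [Br 7 []]]], Br 8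
     [Br 15 [Br 16 []], Br 5 [Br 6 [Br 7 []]]], Br 5 [Br 6 [Br 7 []]]]], Br 5 [Br 11 [Br 12 [Br
     3 [Br 4 [Br 10 []]]], Br 12 [Br 3 [Br 4 [Br 10 []]]]], Br 4 [Br 10 [Br 3 [Br 6 [Br 7
     []]]], Br 3 [Br 6 [Br 7 []]]], Br 4 [Br 10 [Br 3 [Br 6 [Br 7 []]]], Br 3 [Br 6 [Br 7
     []]]]], Br 7 [Br 6 [Br 13 [Br 14 [Br 8 [Br 3 [Br 15 []], Br 3 [Br 9 []]]]]], Br 6 [Br 4
     [Br 10 []]]], Br 7 [Br 6 [Br 13 [Br 14 [Br 21 [Br 22 []]]]], Br 6 [Br 4 [Br 10 []]]]], Br
     10 [Br 6 [Br 7 [Br 13 [Br 14 []], Br 1 [Br 3 [Br 4 [Br 5 []]]]], Br 7 [Br 13 [Br 14 []],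
     Br 1 [Br 3 [Br 4 [Br 5 []]]]]], Br 7 [Br 13 [Br 14 []], Br 1 [Br 3 [Br 4 [Br 5 []]]]], Br
     7 [Br 13 [Br 14 []], Br 1 [Br 3 [Br 4 [Br 5 []]]]]], Br 9 [Br 3 [Br 17 [Br 18 []], Br 17
     [Br 18 []]], Br 8 [Br 3 [Br 15 [Br 16 []]], Br 3 [Br 17 [Br 18 [Br 5 [Br 1 [Br 11 []], Br
     1 [Br 4 []]]]]]], Br 5 [Br 1 [Br 11 []], Br 1 [Br 4 []]]], Br 1 [Br 5 [Br 4 [Br 11 [Br 12
     [Br 19 [Br 20 []]]]], Br 4 [Br 6 [Br 10 []]]], Br 5 [Br 11 [Br 12 []], Br 3 [Br 4 [Br 10
     []]]], Br 8 [Br 3 [Br 15 []], Br 3 [Br 9 []]]]], Br 3 [Br 8 [Br 9 [Br 23 [Br 15 [Br 16 [Br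
     17 [Br 18 [Br 24 [Br 25 []]]]]], Br 15 [Br 16 [Br 24 [Br 25 []]]]], Br 16 [Br 24 [Br 25
     []], Br 15 [Br 23 []]]], Br 9 [Br 23 [Br 17 [Br 15 [Br 16 [Br 18 [Br 24 [Br 25 []]]]]], Br
     17 [Br 18 [Br 26 [Br 27 []]]]], Br 16 [Br 24 [Br 25 []], Br 15 [Br 23 [Br 17 [Br 24 [Br 25
     [Br 30 [Br 31 []]]]]]]]], Br 9 [Br 18 [Br 26 [Br 27 []], Br 17 [Br 23 []]], Br 18 [Br 26
     [Br 27 []], Br 17 [Br 23 [Br 15 [Br 26 [Br 27 [Br 32 [Br 33 []]]]]]]]]], Br 8 [Br 15 [Br
     16 [Br 9 [Br 17 []]], Br 16 [Br 9 [Br 17 [Br 18 []]]]], Br 9 [Br 17 [Br 18 []], Br 1 [Br 2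
     [Br 15 [Br 16 [Br 17 [Br 18 [Br 23 [Br 24 [Br 25 []]]]]]]]]], Br 9 [Br 17 [Br 18 []], Br 1
     [Br 2 [Br 15 [Br 16 [Br 17 [Br 18 [Br 23 [Br 26 [Br 27 []]]]]]]]]]], Br 16 [Br 8 [Br 24
     [Br 25 []], Br 24 [Br 25 []]], Br 15 [Br 8 [Br 23 [Br 9 [Br 17 []]]], Br 8 [Br 24 [Br 25
     [Br 18 [Br 9 [Br 26 []], Br 9 [Br 17 []]]]]]], Br 18 [Br 9 [Br 26 []], Br 9 [Br 17 []]]],
     Br 5 [Br 1 [Br 11 [Br 12 []], Br 11 [Br 12 []]], Br 11 [Br 19 [Br 1 [Br 4 [Br 12 [Br 20
     []]]]], Br 1 [Br 4 []]], Br 4 [Br 1 [Br 10 []], Br 1 [Br 10 [Br 6 [Br 7 [Br 2 [Br 13 []],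
     Br 2 [Br 13 [Br 14 [Br 21 [Br 22 []]]]]]]]]]]], Br 8 [Br 3 [Br 15 [Br 16 [Br 9 [Br 17
     []]], Br 16 [Br 9 [Br 17 [Br 18 []]]]], Br 16 [Br 15 [Br 24 [Br 25 [Br 30 [Br 31 []]]]],
     Br 15 [Br 17 [Br 23 []]]], Br 16 [Br 15 [Br 24 [Br 25 [Br 30 [Br 31 []]]]], Br 15 [Br 23
     [Br 17 [Br 18 [Br 9 [Br 26 []], Br 9 [Br 26 [Br 27 [Br 32 [Br 33 []]]]]]]]]]], Br 16 [Br
     24 [Br 25 [Br 3 [Br 9 [Br 15 [Br 23 []]]]], Br 25 [Br 3 [Br 9 [Br 15 [Br 23 []]]]]], Br 15
     [Br 23 [Br 3 [Br 9 []]], Br 3 [Br 9 []]], Br 23 [Br 15 [Br 3 [Br 9 []]], Br 3 [Br 9 []]]],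
     Br 9 [Br 3 [Br 17 [Br 18 []], Br 17 [Br 18 []]], Br 23 [Br 17 [Br 3 [Br 15 [Br 16 [Br 18
     [Br 26 [Br 27 []]]]]]], Br 3 [Br 17 [Br 18 [Br 26 [Br 27 []]]]]], Br 16 [Br 24 [Br 25 []],
     Br 3 [Br 15 [Br 23 [Br 17 [Br 24 [Br 25 [Br 30 [Br 31 []]]]]]]]]], Br 9 [Br 3 [Br 17 [Br
     18 []], Br 17 [Br 18 []]], Br 18 [Br 26 [Br 27 []], Br 3 [Br 17 [Br 23 []]]], Br 18 [Br 26
     [Br 27 []], Br 3 [Br 17 [Br 23 [Br 15 [Br 26 [Br 27 [Br 32 [Br 33 []]]]]]]]]]]])"
  by code_simp

definition words_three_7 :: "nat list list" where
  "words_three_7 =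
    [[0, 1, 1], [0, 1, 2], [0, 1, 0], [1, 0, 0], [0, 1, 3], [0, 2, 1], [0, 1, 6], [0, 0, 1],
    [1, 0, 1], [1, 0, 6], [0, 1, 4], [0, 2, 2], [0, 2, 0], [0, 1, 5], [0, 0, 2], [0, 0, 0], [1,
    0, 2], [1, 1, 0], [1, 0, 5], [1, 6, 0], [1, 0, 3], [1, 1, 1], [1, 1, 6], [1, 0, 4], [1, 6,
    1], [1, 6, 6]]"

lemma refuted_three_7: "refuted 7 7 3 5 words_three_7 (replicate 26 (replicate 5 True))
  (Br 0 [Br 3 [Br 9 [Br 18 [Br 19 [Br 8 [Br 16 [Br 1 [Br 2 []]], Br 1 [Br 2 []]], Br 8 [Br 16
     [Br 1 [Br 2 []]], Br 1 [Br 2 []]]], Br 1 [Br 2 [Br 8 [Br 16 [Br 17 []]]], Br 2 [Br 8 [Br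
     16 [Br 17 []]]]], Br 1 [Br 2 [Br 8 [Br 16 [Br 17 []]]], Br 2 [Br 8 [Br 16 [Br 17 []]]]]],
     Br 1 [Br 2 [Br 8 [Br 16 []]], Br 2 [Br 8 [Br 16 []]]], Br 1 [Br 2 [Br 8 [Br 16 [Br 17
     []]]], Br 2 [Br 8 [Br 16 [Br 17 []]]]], Br 1 [Br 2 [Br 8 [Br 16 [Br 17 []]]], Br 2 [Br 8
     [Br 16 [Br 17 []]]]]], Br 19 [Br 9 [Br 24 [Br 25 [Br 8 [Br 18 [Br 23 []]]], Br 25 [Br 8
     [Br 18 [Br 23 []]]]], Br 24 [Br 25 [Br 1 [Br 2 []]], Br 1 [Br 2 []]], Br 1 [Br 2 [Br 4 [Br
     5 [Br 10 [Br 11 [Br 12 []]]]]], Br 2 [Br 6 [Br 7 [Br 13 [Br 14 [Br 15 []]]]]]]], Br 1 [Br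
     2 [Br 9 [Br 18 [Br 4 [Br 5 [Br 8 [Br 16 [Br 17 []], Br 16 [Br 17 [Br 20 [Br 21 []]]]]]]],
     Br 4 [Br 5 [Br 10 [Br 11 [Br 12 []]]]]], Br 9 [Br 18 [Br 24 [Br 25 [Br 16 [Br 8 [Br 20
     []], Br 8 [Br 17 []]]]]], Br 4 [Br 5 [Br 18 [Br 23 [Br 16 [Br 20 []]]]]]]], Br 9 [Br 18
     [Br 2 [Br 6 [Br 7 [Br 8 [Br 16 [Br 17 []], Br 16 [Br 17 [Br 20 [Br 21 []]]]]]]]], Br 2 [Br
     6 [Br 7 [Br 13 [Br 14 [Br 15 []]]]]]], Br 18 [Br 9 [Br 2 [Br 6 [Br 7 [Br 23 [Br 16 [Br 20
     []]]]]]], Br 2 [Br 9 [Br 24 [Br 25 [Br 16 [Br 8 [Br 20 []], Br 8 [Br 17 []]]]]]]]], Br 1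
     [Br 2 [Br 16 [Br 8 [Br 20 []], Br 8 [Br 17 []]]], Br 2 [Br 16 [Br 8 [Br 20 []], Br 8 [Br
     17 []]]]], Br 17 [Br 8 [Br 21 [Br 22 []], Br 1 [Br 2 []]], Br 16 [Br 8 [Br 1 [Br 2 []]],
     Br 1 [Br 2 []]], Br 1 [Br 2 []]]], Br 1 [Br 2 [Br 10 [Br 4 [Br 5 [Br 11 [Br 12 []]]], Br 4
     [Br 5 [Br 11 [Br 12 []]]]], Br 5 [Br 11 [Br 12 []], Br 4 [Br 10 []]]], Br 13 [Br 6 [Br 2
     [Br 10 []], Br 2 [Br 7 [Br 10 [Br 4 [Br 14 [Br 15 []]]]]]], Br 2 [Br 4 [Br 10 []]], Br 2
     [Br 6 [Br 7 [Br 14 [Br 15 []]]]]], Br 2 [Br 7 [Br 14 [Br 15 []], Br 6 [Br 13 []]], Br 13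
     [Br 6 [Br 10 []], Br 4 [Br 10 []]]]], Br 1 [Br 2 [Br 10 [Br 4 [Br 5 [Br 11 [Br 12 []]]],
     Br 4 [Br 5 [Br 11 [Br 12 []]]]], Br 5 [Br 11 [Br 12 []], Br 4 [Br 10 []]]], Br 13 [Br 6
     [Br 2 [Br 10 []], Br 2 [Br 7 [Br 10 [Br 4 [Br 14 [Br 15 []]]]]]], Br 2 [Br 4 [Br 10 []]],
     Br 2 [Br 6 [Br 7 [Br 14 [Br 15 []]]]]], Br 2 [Br 7 [Br 14 [Br 15 []], Br 6 [Br 13 []]], Br
     13 [Br 6 [Br 10 []], Br 4 [Br 10 []]]]]], Br 1 [Br 4 [Br 5 [Br 2 [Br 6 [Br 3 [Br 7 [Br 8
     [Br 9 []]]]], Br 3 [Br 6 [Br 8 [Br 9 []]]]], Br 2 [Br 6 [Br 3 [Br 7 [Br 8 [Br 9 []]]]], Br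
     3 [Br 6 [Br 8 [Br 9 []]]]]], Br 3 [Br 8 [Br 9 [Br 2 [Br 5 [Br 6 [Br 7 []]]]], Br 5 [Br 2
     [Br 6 [Br 7 []]]]], Br 5 [Br 2 [Br 6 []]], Br 5 [Br 2 [Br 6 [Br 7 []]]]], Br 3 [Br 8 [Br 9
     [Br 2 [Br 5 [Br 6 [Br 7 []]]]], Br 5 [Br 2 [Br 6 [Br 7 []]]]], Br 5 [Br 2 [Br 6 []]], Br 5
     [Br 2 [Br 6 [Br 7 []]]]]], Br 3 [Br 8 [Br 9 [Br 2 [Br 6 []]], Br 9 [Br 2 [Br 6 []]]], Br 2
     [Br 6 [Br 7 []], Br 4 [Br 5 [Br 6 [Br 7 [Br 8 [Br 9 [Br 10 [Br 13 []]]]]]]]], Br 2 [Br 6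
     [Br 7 []], Br 4 [Br 5 [Br 6 [Br 7 [Br 8 [Br 9 [Br 10 [Br 13 []]]]]]]]]], Br 3 [Br 8 [Br 9
     [Br 2 [Br 6 [Br 7 []]]], Br 9 [Br 2 [Br 6 [Br 7 []]]]], Br 2 [Br 6 [Br 7 []], Br 4 [Br 5
     [Br 6 [Br 7 [Br 8 [Br 9 [Br 16 [Br 17 []]]]]]]]], Br 2 [Br 6 [Br 7 []], Br 4 [Br 5 [Br 6
     [Br 7 [Br 8 [Br 9 [Br 10 [Br 13 []]]]]]]]]], Br 3 [Br 8 [Br 9 [Br 2 [Br 6 [Br 7 []]]], Br
     9 [Br 2 [Br 6 [Br 7 []]]]], Br 2 [Br 6 [Br 7 []], Br 4 [Br 5 [Br 6 [Br 7 [Br 8 [Br 9 [Br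
     16 [Br 17 []]]]]]]]], Br 2 [Br 6 [Br 7 []], Br 4 [Br 5 [Br 6 [Br 7 [Br 8 [Br 9 [Br 10 [Br
     13 []]]]]]]]]]], Br 2 [Br 1 [Br 4 [Br 5 [Br 10 [Br 13 [Br 6 [Br 7 []]], Br 6 [Br 7 []]],
     Br 10 [Br 13 [Br 6 [Br 7 []]], Br 6 [Br 7 []]]], Br 6 [Br 7 [Br 5 [Br 10 [Br 13 []]]], Br
     5 [Br 7 [Br 11 [Br 12 [Br 3 [Br 8 [Br 9 []], Br 8 [Br 9 [Br 16 [Br 17 []]]]]]]]]], Br 6
     [Br 7 [Br 5 [Br 10 [Br 13 []]]], Br 5 [Br 7 [Br 14 [Br 15 [Br 3 [Br 8 [Br 9 []], Br 8 [Br
     9 [Br 16 [Br 17 []]]]]]]]]]], Br 4 [Br 10 [Br 5 [Br 11 [Br 12 []], Br 3 [Br 6 [Br 7 []]]],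
     Br 5 [Br 11 [Br 12 []], Br 3 [Br 6 [Br 7 []]]]], Br 5 [Br 11 [Br 12 []], Br 3 [Br 6 [Br 7
     []]]], Br 5 [Br 11 [Br 12 []], Br 3 [Br 6 [Br 7 []]]]], Br 6 [Br 7 [Br 10 [Br 13 []]], Br
     7 [Br 14 [Br 15 [Br 8 [Br 3 [Br 16 []], Br 3 [Br 9 []]]]]]], Br 6 [Br 7 [Br 10 [Br 13
     []]], Br 7 [Br 14 [Br 15 [Br 3 [Br 8 [Br 9 []], Br 8 [Br 9 [Br 16 [Br 17 []]]]]]]]]], Br
     13 [Br 6 [Br 7 [Br 14 [Br 15 []], Br 1 [Br 3 [Br 4 [Br 5 []]]]], Br 7 [Br 14 [Br 15 []],
     Br 1 [Br 3 [Br 4 [Br 5 []]]]]], Br 7 [Br 14 [Br 15 []], Br 1 [Br 3 [Br 4 [Br 5 []]]]], Br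
     7 [Br 14 [Br 15 []], Br 1 [Br 3 [Br 4 [Br 5 []]]]]], Br 4 [Br 1 [Br 10 [Br 3 [Br 5 [Br 11
     []]]], Br 10 [Br 6 [Br 13 []]]], Br 13 [Br 10 [Br 1 [Br 5 []]], Br 1 [Br 5 []]], Br 8 [Br
     3 [Br 16 []], Br 3 [Br 9 []]]], Br 3 [Br 8 [Br 9 [Br 16 [Br 17 [Br 20 [Br 21 [Br 22
     []]]]]], Br 9 [Br 18 [Br 19 [Br 23 [Br 24 [Br 25 []]]]]]], Br 8 [Br 16 [Br 17 []], Br 1
     [Br 4 [Br 5 []]]], Br 5 [Br 1 [Br 11 []], Br 1 [Br 4 []]]]], Br 9 [Br 3 [Br 18 [Br 19 [Br
     8 [Br 16 []]], Br 19 [Br 8 [Br 16 [Br 17 []]]]], Br 18 [Br 19 [Br 20 [Br 23 []]], Br 19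
     [Br 24 [Br 25 [Br 17 [Br 8 [Br 21 []], Br 8 [Br 16 []]]]]]], Br 8 [Br 16 [Br 17 [Br 20 [Br
     23 [Br 18 [Br 19 []]]]], Br 17 [Br 18 [Br 19 [Br 20 [Br 23 []]]]]], Br 17 [Br 21 [Br 22
     []], Br 16 [Br 20 []]], Br 18 [Br 19 []]]], Br 19 [Br 24 [Br 25 [Br 3 [Br 8 [Br 18 [Br 23
     []]]]], Br 25 [Br 3 [Br 8 [Br 18 [Br 23 []]]]]], Br 23 [Br 18 [Br 3 [Br 8 []]], Br 3 [Br 8
     []]], Br 18 [Br 23 [Br 3 [Br 8 []]], Br 3 [Br 8 []]]], Br 8 [Br 3 [Br 16 [Br 17 []], Br 16
     [Br 17 []]], Br 20 [Br 16 [Br 3 [Br 17 [Br 21 [Br 22 []]]]], Br 3 [Br 16 [Br 17 [Br 21 [Br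
     22 []]]]]], Br 23 [Br 18 [Br 20 []], Br 16 [Br 20 []]]], Br 8 [Br 3 [Br 16 [Br 17 []], Br
     16 [Br 17 []]], Br 17 [Br 21 [Br 22 []], Br 3 [Br 16 [Br 20 []]]], Br 23 [Br 18 [Br 20
     []], Br 16 [Br 20 []]]]], Br 9 [Br 3 [Br 18 [Br 19 [Br 8 [Br 16 []]], Br 19 [Br 8 [Br 16
     [Br 17 []]]]], Br 18 [Br 19 [Br 20 [Br 23 []]], Br 19 [Br 24 [Br 25 [Br 16 [Br 8 [Br 20
     []], Br 8 [Br 17 []]]]]]], Br 8 [Br 16 [Br 17 [Br 20 [Br 23 [Br 18 [Br 19 []]]]], Br 17
     [Br 18 [Br 19 [Br 20 [Br 23 []]]]]], Br 17 [Br 21 [Br 22 []], Br 16 [Br 20 []]], Br 18 [Br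
     19 []]]], Br 19 [Br 24 [Br 25 [Br 3 [Br 8 [Br 18 [Br 23 []]]]], Br 25 [Br 3 [Br 8 [Br 18
     [Br 23 []]]]]], Br 23 [Br 18 [Br 3 [Br 8 []]], Br 3 [Br 8 []]], Br 18 [Br 23 [Br 3 [Br 8
     []]], Br 3 [Br 8 []]]], Br 8 [Br 3 [Br 16 [Br 17 []], Br 16 [Br 17 []]], Br 20 [Br 16 [Br
     3 [Br 17 [Br 21 [Br 22 []]]]], Br 3 [Br 16 [Br 17 [Br 21 [Br 22 []]]]]], Br 23 [Br 18 [Br
     20 []], Br 16 [Br 20 []]]], Br 8 [Br 3 [Br 16 [Br 17 []], Br 16 [Br 17 []]], Br 17 [Br 21
     [Br 22 []], Br 3 [Br 16 [Br 20 []]]], Br 23 [Br 18 [Br 20 []], Br 16 [Br 20 []]]]]])"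
  by code_simp

section \<open>Alternation around odd cycles\<close>

lemma alternating_centres:
  assumes f: "packing_coloring (sierp_verts k 2) (sierp_adj (cycle_adj k)) 4 f" and k: "k \<ge> 8"
  shows "f [4, 4] = 1 \<longleftrightarrow> f [3, 3] \<noteq> 1"
proof -
  let ?g = "\<lambda>i. f (words_parity ! i) - 1"
  have words: "words_parity ! 0 = [3, 3]" "words_parity ! 1 = [4, 4]" "length words_parity = 24"
    by (simp_all add: words_parity_def)
  have range: "1 \<le> f (words_parity ! i) \<and> f (words_parity ! i) \<le> 4" if "i < 24" for i
    using refuted_range[OF refuted_both k _ f] that words(3) by simp
  have no: "\<not> admits 24 ?g (replicate 2 (True # replicate 3 False) @ replicate 22 (replicate 4 True))"
    "\<not> admits 24 ?g (replicate 2 (False # replicate 3 True) @ replicate 22 (replicate 4 True))"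
    using refuted_sound[OF refuted_both _ k f] refuted_sound[OF refuted_none _ k f] words(3)
    by simp_all
  have nth: "(b # replicate 3 (\<not> b)) ! (x - 1) \<longleftrightarrow> (x = 1 \<longleftrightarrow> b)" if "1 \<le> x" "x \<le> 4" for b and x :: nat
    using that by (auto simp: nth_Cons')
  \<comment> \<open>One statement serves both trees: \<open>b\<close> tells whether the two middle
    vertices have colour 1, and their lists allow either this colour only or the other
    three.\<close>
  have "admits 24 ?g (replicate 2 (b # replicate 3 (\<not> b)) @ replicate 22 (replicate 4 True))"
    if "f [3, 3] = 1 \<longleftrightarrow> b" "f [4, 4] = 1 \<longleftrightarrow> b" for b
    unfolding admits_def
  proof (intro conjI allI impI)
    fix i :: nat assume i: "i < 24"
    let ?ds = "replicate 2 (b # replicate 3 (\<not> b)) @ replicate 22 (replicate 4 True)"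
    have g: "?g i < 4" using range[OF i] by linarith
    have "i < 2 \<longrightarrow> (f (words_parity ! i) = 1 \<longleftrightarrow> b)"
      using that words(1,2) by (auto simp: less_2_cases_iff)
    then have "(if i < 2 then b # replicate 3 (\<not> b) else replicate 4 True) ! ?g i"
      using nth range[OF i] g by auto
    moreover have "?ds ! i = (if i < 2 then b # replicate 3 (\<not> b) else replicate 4 True)"
      using i by (simp add: nth_append)
    ultimately show "?g i < length (?ds ! i)" "?ds ! i ! ?g i" using g by simp_all
  qed simp
  from this[of True] this[of False] no show ?thesis by auto
qed

text \<open>The window of the alternation argument needs eight different letters, so
  \<open>k = 7\<close> is refuted directly.\<close>

lemma not_colorable_two_odd:
  assumes "odd k" "k \<ge> 7"
  shows "\<not> colorable 2 k 4"
proof (cases "k = 7")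
  case True
  show ?thesis unfolding True
    by (rule refuted_imp_not_colorable[OF refuted_two_7])
      (simp_all add: words_two_7_def)
next
  case False
  then have k: "k \<ge> 8" using assms by simp
  show ?thesis
  proof
    assume "colorable 2 k 4"
    then obtain f where f: "packing_coloring (sierp_verts k 2) (sierp_adj (cycle_adj k)) 4 f"
      unfolding colorable_def by blast
    have "f (map (\<lambda>x. (x + r) mod k) [4, 4]) = 1 \<longleftrightarrow> f (map (\<lambda>x. (x + r) mod k) [3, 3]) \<noteq> 1" for r
      by (rule alternating_centres[OF packing_coloring_rotate[OF f] k])
    \<comment> \<open>The shift stands for \<open>r - 3\<close> modulo \<open>k\<close> without
      leaving the naturals; it moves the centres 3 and 4 to \<open>r\<close> and
      \<open>r + 1\<close>.\<close>
    note step = this[of "r + (k - 3)" for r]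
    have "f [Suc r mod k, Suc r mod k] = 1 \<longleftrightarrow> f [r mod k, r mod k] \<noteq> 1" for r
    proof -
      have "Suc (r + k) mod k = Suc r mod k" by (metis add_Suc mod_add_self2)
      then show ?thesis using step[of r] k by (simp add: mod_simps)
    qed
    then show False
      by (rule no_alternation_on_odd_cycle[OF assms(1), of "\<lambda>r. f [r, r] = 1"])
  qed
qed

lemma pair_colored_5:
  assumes f: "packing_coloring (sierp_verts 5 2) (sierp_adj (cycle_adj 5)) 5 f"
  shows "\<exists>u\<in>set words_pair. f u = 5"
proof (rule ccontr)
  assume no: "\<not> (\<exists>u\<in>set words_pair. f u = 5)"
  have len: "length words_pair = 10" by (simp add: words_pair_def)
  have "admits 10 (\<lambda>i. f (words_pair ! i) - 1) (replicate 10 (replicate 4 True @ [False]))"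
    unfolding admits_def
  proof (intro conjI allI impI)
    fix i :: nat assume i: "i < 10"
    then have "1 \<le> f (words_pair ! i)" "f (words_pair ! i) \<le> 5"
      using refuted_range[OF refuted_pair order_refl _ f] len by auto
    moreover have "f (words_pair ! i) \<noteq> 5" using no i len nth_mem by metis
    ultimately have "f (words_pair ! i) - 1 < 4" by linarith
    then show "f (words_pair ! i) - 1 < length (replicate 10 (replicate 4 True @ [False]) ! i)"
      "replicate 10 (replicate 4 True @ [False]) ! i ! (f (words_pair ! i) - 1)"
      using i by (simp_all add: nth_append)
  qed simp
  then show False using refuted_sound[OF refuted_pair _ order_refl f] len by simp
qed

text \<open>Index \<open>4\<close> belongs to colour 5. Two 5-cycles joined by an edge have diameter
  2 + 1 + 2 = 5, so this colour fits at most once into two adjacent blocks.\<close>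

lemma pair_close:
  "list_all (\<lambda>i. list_all (\<lambda>j. i = j \<or> conflicts (adj_table 5 words_pair) 5 ! 4 ! i ! j) [0..<10]) [0..<10]"
  by code_simp

lemma pair_unique_5:
  assumes f: "packing_coloring (sierp_verts 5 2) (sierp_adj (cycle_adj 5)) 5 f"
    and uv: "u \<in> set words_pair" "v \<in> set words_pair" "f u = 5" "f v = 5"
  shows "u = v"
proof (rule ccontr)
  assume "u \<noteq> v"
  let ?V = "sierp_verts 5 2" and ?E = "sierp_adj (cycle_adj 5)"
  have len: "length words_pair = 10" "length (adj_table 5 words_pair) = 10"
    by (simp_all add: words_pair_def adj_table_def)
  obtain i j where ij: "i < 10" "j < 10" "u = words_pair ! i" "v = words_pair ! j"
    using uv len unfolding in_set_conv_nth by auto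
  have "i = j \<or> conflicts (adj_table 5 words_pair) 5 ! 4 ! i ! j"
    by (rule bspec[OF bspec[OF pair_close[unfolded list_all_iff]]]) (use ij in simp_all)
  moreover have "i \<noteq> j" using ij \<open>u \<noteq> v\<close> by auto
  ultimately have "conflicts (adj_table 5 words_pair) 5 ! 4 ! i ! j" by metis
  then obtain m where "m \<le> 5" "(adj_on ?V ?E ^^ m) u v"
    using conflicts_sound(2)[where \<phi> = "(!) words_pair" and V = ?V and E = ?E and x = 4 and c = 5,
        OF refuted_adj_on[OF refuted_pair]] ij len by auto
  moreover have "u \<in> ?V" "v \<in> ?V"
    using refuted_verts[OF refuted_pair order_refl] ij len by auto
  ultimately show False
    using f uv(3,4) \<open>u \<noteq> v\<close> unfolding packing_coloring_iff by fastforce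
qed

lemma ex_rotate:
  assumes "k > (0::nat)"
  shows "(\<exists>j<k. Q ((j + r) mod k)) \<longleftrightarrow> (\<exists>j<k. Q j)"
proof
  assume "\<exists>j<k. Q j"
  then obtain j where j: "j < k" "Q j" by blast
  \<comment> \<open>Adding \<open>k - r mod k\<close> undoes the rotation by
    \<open>r\<close>.\<close>
  have "((j + (k - r mod k)) mod k + r) mod k = (j + (k - r mod k) + r mod k) mod k"
    by (simp only: mod_simps)
  also have "\<dots> = (j + k) mod k"
    using mod_less_divisor[OF assms, of r] by simp
  finally have "((j + (k - r mod k)) mod k + r) mod k = j" using j by simp
  then show "\<exists>j<k. Q ((j + r) mod k)"
    using j assms by (intro exI[of _ "(j + (k - r mod k)) mod k"]) simp
qed (use assms mod_less_divisor in blast)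

text \<open>Two adjacent blocks cannot do without colour 5 and have no room for it twice; hence
  containing it alternates from block to block.\<close>

lemma not_colorable_two_5: "\<not> colorable 2 5 5"
proof
  assume "colorable 2 5 5"
  then obtain f where f: "packing_coloring (sierp_verts 5 2) (sierp_adj (cycle_adj 5)) 5 f"
    unfolding colorable_def by blast
  define P where "P r \<longleftrightarrow> (\<exists>j<5. f [r, j] = 5)" for r
  have words: "set words_pair = {[i, j] |i j. i < 2 \<and> j < 5}"
    by (auto simp: words_pair_def less_2_cases_iff numeral_eq_Suc less_Suc_eq)
  have "P (Suc r mod 5) \<longleftrightarrow> \<not> P (r mod 5)" for r
  proof -
    let ?g = "\<lambda>u. f (map (\<lambda>x. (x + r) mod 5) u)"
    have g: "packing_coloring (sierp_verts 5 2) (sierp_adj (cycle_adj 5)) 5 ?g"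
      by (rule packing_coloring_rotate[OF f])
    have 0: "P (r mod 5) \<longleftrightarrow> (\<exists>j<5. ?g [0, j] = 5)"
      unfolding P_def by (subst ex_rotate[symmetric, where r = r]) simp_all
    have 1: "P (Suc r mod 5) \<longleftrightarrow> (\<exists>j<5. ?g [1, j] = 5)"
      unfolding P_def by (subst ex_rotate[symmetric, where r = r]) simp_all
    have "\<exists>i<2. \<exists>j<5. ?g [i, j] = 5"
      using pair_colored_5[OF g] unfolding words by blast
    then have "P (r mod 5) \<or> P (Suc r mod 5)" unfolding 0 1 by (auto simp: less_2_cases_iff)
    moreover have "\<not> (P (r mod 5) \<and> P (Suc r mod 5))"
    proof
      assume "P (r mod 5) \<and> P (Suc r mod 5)"
      then obtain i j where ij: "i < 5" "?g [0, i] = 5" "j < 5" "?g [1, j] = 5"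
        unfolding 0 1 by blast
      have "[0, i] \<in> set words_pair" "[1, j] \<in> set words_pair"
        unfolding words using ij(1,3) by auto
      from pair_unique_5[OF g this ij(2,4)] show False by simp
    qed
    ultimately show ?thesis by blast
  qed
  then show False by (rule no_alternation_on_odd_cycle[of 5, rotated]) simp
qed

lemma not_colorable_two_three:
  assumes "k \<ge> 4"
  shows "\<not> colorable 2 k 3"
  by (rule refuted_imp_not_colorable[OF refuted_three]) (use assms in \<open>simp_all add: words_three_def\<close>)

lemma not_colorable_two_6: "\<not> colorable 2 6 4"
  by (rule refuted_imp_not_colorable[OF refuted_two_6]) (simp_all add: words_two_6_def)

text \<open>The link window uses six letters, so \<open>k = 4\<close> has a window of its own;
  \<open>k = 5\<close> is left to the stronger bound already valid for \<open>n = 2\<close>.\<close>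

lemma not_colorable_three:
  assumes "k \<ge> 6 \<or> k = 4"
  shows "\<not> colorable 3 k 4"
proof (cases "k = 4")
  case True
  show ?thesis unfolding True
    by (rule refuted_imp_not_colorable[OF refuted_three_4]) (simp_all add: words_three_4_def)
next
  case False
  then show ?thesis using assms
    by (intro refuted_imp_not_colorable[OF refuted_link]) (simp_all add: words_link_def)
qed

lemma not_colorable_three_6: "\<not> colorable 3 6 5"
  by (rule refuted_imp_not_colorable[OF refuted_three_6]) (simp_all add: words_three_6_def)

lemma not_colorable_three_7: "\<not> colorable 3 7 5"
  by (rule refuted_imp_not_colorable[OF refuted_three_7]) (simp_all add: words_three_7_def)

section \<open>The values of the packing chromatic number\<close>

lemma chi_rho_SC_eqI:
  assumes "colorable n k (Suc c)" "\<not> colorable m k c" "m \<le> n" "k > 0"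
  shows "chi_rho_SC n k = Suc c"
  using assms colorable_prefix[OF _ assms(3,4)] unfolding chi_rho_SC_def colorable_def
  by (metis packing_chromatic_eqI)

theorem theorem4:
  fixes n k :: nat
  assumes "n \<ge> 2" and "k \<ge> 4"
  shows "(n = 2 \<and> even k \<and> k \<noteq> 6 \<longrightarrow> chi_rho_SC n k = 4)
       \<and> ((n \<ge> 3 \<and> k \<notin> {5, 6, 7}) \<or> (n = 2 \<and> (k = 6 \<or> (odd k \<and> k \<noteq> 5)))
            \<longrightarrow> chi_rho_SC n k = 5)
       \<and> ((n \<ge> 3 \<and> k \<in> {6, 7}) \<or> (n \<le> 6 \<and> k = 5) \<longrightarrow> chi_rho_SC n k = 6)
       \<and> (n \<ge> 7 \<longrightarrow> 6 \<le> chi_rho_SC n 5 \<and> chi_rho_SC n 5 \<le> 7)"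
proof -
  have five: "chi_rho_SC n 5 = 6"
    using chi_rho_SC_eqI[of n 5 5 2] colorable_5 not_colorable_two_5 assms(1) by simp
  have "chi_rho_SC n k = 4" if "n = 2" "even k" "k \<noteq> 6"
    using chi_rho_SC_eqI[of n k 3 2] colorable_two_even not_colorable_two_three assms that by simp
  moreover have "chi_rho_SC n k = 5" if "n \<ge> 3" "k \<notin> {5, 6, 7}"
  proof -
    have "colorable n k 5"
    proof (cases "even k")
      case True
      then show ?thesis using colorable_even[of k n] assms that by simp
    next
      case False
      have "k \<noteq> 8" using False by auto
      moreover have "k \<noteq> 4" using False by auto
      ultimately have "k \<ge> 9" using assms(2) that(2) by auto
      then show ?thesis using colorable_odd[of k n] False assms(1) by simp
    qed
    moreover have "\<not> colorable 3 k 4"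
    proof (rule not_colorable_three)
      show "k \<ge> 6 \<or> k = 4" using assms(2) that(2) by (cases "k = 5") auto
    qed
    ultimately show ?thesis using chi_rho_SC_eqI[of n k 4 3] that(1) assms(2) by simp
  qed
  moreover have "chi_rho_SC n k = 5" if nk: "n = 2" "k = 6 \<or> (odd k \<and> k \<noteq> 5)"
  proof -
    consider "k = 6" | "k = 7" | "odd k" "k \<ge> 9"
    proof (cases "k = 6 \<or> k = 7")
      case False
      then have k: "odd k" "k \<noteq> 5" "k \<noteq> 6" "k \<noteq> 7" using nk(2) by auto
      moreover have "k \<noteq> 8" "k \<noteq> 4" using k(1) by auto
      ultimately show ?thesis using that assms(2) by auto
    qed blast
    then show ?thesis
    proof cases
      case 1
      then show ?thesis using chi_rho_SC_eqI[of 2 6 4 2] colorable_two_6 not_colorable_two_6 nk(1) by simp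
    next
      case 2
      then show ?thesis
        using chi_rho_SC_eqI[of 2 7 4 2] colorable_two_7 not_colorable_two_odd[of 7] nk(1) by simp
    next
      case 3
      then show ?thesis
        using chi_rho_SC_eqI[of 2 k 4 2] colorable_odd[of k 2] not_colorable_two_odd[of k] nk(1) by simp
    qed
  qed
  moreover have "chi_rho_SC n k = 6" if "n \<ge> 3" "k \<in> {6, 7}"
    using that chi_rho_SC_eqI[of n k 5 3] colorable_6[of n] colorable_7[of n]
      not_colorable_three_6 not_colorable_three_7 by auto
  ultimately show ?thesis using five by auto
qed

end
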